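(* Let $n\in\mathbb N$, $s\in(1,\infty)\setminus\mathbb N$ and let $A$ be a Young function. Assume that the embedding $$V^{s,A}_{d,1}(\mathbb R^n)\to\mathcal L^\varphi(\mathbb R^n)$$ holds for some admissible function $\varphi$. Then $s\in(1,n+1)\setminus\mathbb N$, and $$\int_0\left(\frac t{A(t)}\right)^{\frac{s-1}{n+1-s}}dt<\infty .$$
   Context: A Young function is a convex, left-continuous function $A:[0,\infty)\to[0,\infty]$, non-constant in $(0,\infty)$, with $A(0)=0$. The notation $\int_0(\cdots)\,dt<\infty$ means convergence of the integral on $(0,\delta)$ for some $\delta>0$. For $s\in(0,\infty)\setminus\mathbb N$, $[s]$ and $\{s\}=s-[s]$ denote the integer and fractional parts. For $\sigma\in(0,1)$ and a measurable, possibly vector-valued, $v$ on $\mathbb R^n$, set $$J_{\sigma,A}(v)=\int_{\mathbb R^n}\int_{\mathbb R^n}A\left(\frac{|v(x)-v(y)|}{|x-y|^\sigma}\right)\frac{dx\,dy}{|x-y|^n},\qquad |v|_{\sigma,A,\mathbb R^n}=\inf\{\lambda>0:J_{\sigma,A}(v/\lambda)\le1\},$$ with $|\cdot|$ the Euclidean norm. Define $V^{s,A}(\mathbb R^n)$ as the set of measurable $u:\mathbb R^n\to\mathbb R$ that are $[s]$-times weakly differentiable with $|\nabla^{[s]}u|_{\{s\},A,\mathbb R^n}<\infty$, with seminorm $|\nabla^{[s]}u|_{\{s\},A,\mathbb R^n}$, and $$V^{s,A}_{d,1}(\mathbb R^n)=\{u\in V^{s,A}(\mathbb R^n):\ |\{|\nabla^hu|>t\}|<\infty\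 \text{for every } t>0 \text{ and } h=1,\dots,[s]\}.$$ A function $\varphi:(0,\infty)\to(0,\infty)$ is admissible if $\inf_{r\in[a,\infty)}\varphi(r)>0$ for every $a\in(0,\infty)$. The Campanato space $\mathcal L^\varphi(\mathbb R^n)$ consists of all $u\in L^1_{\rm loc}(\mathbb R^n)$ such that $$|u|_{\mathcal L^\varphi(\mathbb R^n)}=\sup_B\frac1{\varphi(|B|^{1/n})}\frac1{|B|}\int_B|u-u_B|\,dx<\infty,$$ where the supremum is over all balls $B\subset\mathbb R^n$, $|B|$ is the Lebesgue measure and $u_B=\frac1{|B|}\int_Bu\,dx$. The arrow $\to$ denotes a continuous embedding, i.e. inclusion together with a bound $|u|_{\mathcal L^\varphi(\mathbb R^n)}\le c\,|\nabla^{[s]}u|_{\{s\},A,\mathbb R^n}$ for some constant $c$. *)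

theory Defs
  imports "HOL-Analysis.Analysis"
begin

text \<open>
  \<open>\<real>\<^sup>n\<close> is \<^typ>\<open>real ^ 'n\<close>, with \<open>n\<close> = \<^term>\<open>CARD('n)\<close>; measurability and null sets are meant in
  the sense of Lebesgue.
\<close>

definition young_function :: "(real \<Rightarrow> ennreal) \<Rightarrow> bool" where
  "young_function A \<longleftrightarrow>
     A 0 = 0 \<and>
     (\<forall>x\<ge>0. \<forall>y\<ge>0. \<forall>\<theta>\<in>{0..1}.
        A ((1 - \<theta>) * x + \<theta> * y) \<le> ennreal (1 - \<theta>) * A x + ennreal \<theta> * A y) \<and>
     (\<forall>t>0. continuous (at_left t) A) \<and>
     \<not> A constant_on {0<..}"

subsection \<open>Weak derivatives\<close>

definition partial_deriv :: "'n::finite \<Rightarrow> (real ^ 'n \<Rightarrow> real) \<Rightarrow> real ^ 'n \<Rightarrow> real" where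
  "partial_deriv i f x = frechet_derivative f (at x) (axis i 1)"

text \<open>
  Derivatives of order \<open>h\<close> are indexed by lists \<open>[i\<^sub>1, \<dots>, i\<^sub>h]\<close> of coordinate directions, which
  stand for \<open>\<partial>\<^bsub>i\<^sub>1\<^esub> \<dots> \<partial>\<^bsub>i\<^sub>h\<^esub>\<close>.
\<close>

definition iter_partial :: "'n::finite list \<Rightarrow> (real ^ 'n \<Rightarrow> real) \<Rightarrow> real ^ 'n \<Rightarrow> real" where
  "iter_partial ds f = foldr partial_deriv ds f"

text \<open>
  The space \<open>C\<^sub>c\<^sup>\<infinity>\<close>: differentiability of all iterated partial derivatives also makes them all
  continuous.
\<close>

definition test_function :: "(real ^ 'n::finite \<Rightarrow> real) \<Rightarrow> bool" where
  "test_function \<psi> \<longleftrightarrow>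
     (\<forall>ds. iter_partial ds \<psi> differentiable_on UNIV) \<and> compact (closure {x. \<psi> x \<noteq> 0})"

definition locally_integrable :: "(real ^ 'n::finite \<Rightarrow> real) \<Rightarrow> bool" where
  "locally_integrable u \<longleftrightarrow> (\<forall>K. compact K \<longrightarrow> set_integrable lebesgue K u)"

definition has_weak_partial ::
    "(real ^ 'n::finite \<Rightarrow> real) \<Rightarrow> 'n list \<Rightarrow> (real ^ 'n \<Rightarrow> real) \<Rightarrow> bool" where
  "has_weak_partial u ds g \<longleftrightarrow>
     locally_integrable u \<and> locally_integrable g \<and>
     (\<forall>\<psi>. test_function \<psi> \<longrightarrow>
        (LINT x|lebesgue. u x * iter_partial ds \<psi> x) =
        (- 1) ^ length ds * (LINT x|lebesgue. g x * \<psi> x))"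

definition weakly_differentiable :: "nat \<Rightarrow> (real ^ 'n::finite \<Rightarrow> real) \<Rightarrow> bool" where
  "weakly_differentiable m u \<longleftrightarrow> (\<forall>ds. length ds \<le> m \<longrightarrow> (\<exists>g. has_weak_partial u ds g))"

text \<open>
  Weak derivatives are unique up to null sets, and no notion below depends on the
  representative chosen here.
\<close>

definition weak_partial :: "'n::finite list \<Rightarrow> (real ^ 'n \<Rightarrow> real) \<Rightarrow> real ^ 'n \<Rightarrow> real" where
  "weak_partial ds u = (SOME g. has_weak_partial u ds g)"

text \<open>
  A function \<open>v\<close> with values in \<open>\<real>\<^sup>I\<close>, for a finite index set \<open>I\<close>, is a map
  \<open>v :: real ^ 'n \<Rightarrow> 'i \<Rightarrow> real\<close> evaluated at indices in \<open>I\<close> only, and \<^term>\<open>L2_set (v x) I\<close> is the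
  Euclidean norm of \<open>v x\<close>. In particular \<open>\<nabla>\<^sup>h u\<close> is the array \<^term>\<open>weak_grad u\<close> restricted to
  \<^term>\<open>order_idx h\<close>.
\<close>

definition order_idx :: "nat \<Rightarrow> 'n::finite list set" where
  "order_idx h = {ds. length ds = h}"

definition weak_grad :: "(real ^ 'n::finite \<Rightarrow> real) \<Rightarrow> real ^ 'n \<Rightarrow> 'n list \<Rightarrow> real" where
  "weak_grad u x ds = weak_partial ds u x"

subsection \<open>Fractional Orlicz--Sobolev spaces\<close>

definition frac_modular ::
    "real \<Rightarrow> (real \<Rightarrow> ennreal) \<Rightarrow> 'i set \<Rightarrow> (real ^ 'n::finite \<Rightarrow> 'i \<Rightarrow> real) \<Rightarrow> ennreal" where
  "frac_modular \<sigma> A I v =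
     (\<integral>\<^sup>+x. \<integral>\<^sup>+y. A (L2_set (\<lambda>i. v x i - v y i) I / norm (x - y) powr \<sigma>) /
        ennreal (norm (x - y) ^ CARD('n)) \<partial>lebesgue \<partial>lebesgue)"

definition frac_seminorm ::
    "real \<Rightarrow> (real \<Rightarrow> ennreal) \<Rightarrow> 'i set \<Rightarrow> (real ^ 'n::finite \<Rightarrow> 'i \<Rightarrow> real) \<Rightarrow> ennreal" where
  "frac_seminorm \<sigma> A I v =
     Inf {ennreal l |l. l > 0 \<and> frac_modular \<sigma> A I (\<lambda>x i. v x i / l) \<le> 1}"

definition V_seminorm ::
    "real \<Rightarrow> (real \<Rightarrow> ennreal) \<Rightarrow> (real ^ 'n::finite \<Rightarrow> real) \<Rightarrow> ennreal" where
  "V_seminorm s A u = frac_seminorm (frac s) A (order_idx (nat \<lfloor>s\<rfloor>)) (weak_grad u)"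

definition V_space ::
    "real \<Rightarrow> (real \<Rightarrow> ennreal) \<Rightarrow> (real ^ 'n::finite \<Rightarrow> real) set" where
  "V_space s A =
     {u. u \<in> borel_measurable lebesgue \<and> weakly_differentiable (nat \<lfloor>s\<rfloor>) u \<and>
         V_seminorm s A u < \<infinity>}"

definition V_space_d1 ::
    "real \<Rightarrow> (real \<Rightarrow> ennreal) \<Rightarrow> (real ^ 'n::finite \<Rightarrow> real) set" where
  "V_space_d1 s A =
     {u \<in> V_space s A. \<forall>t>0. \<forall>h\<in>{1..nat \<lfloor>s\<rfloor>}.
        emeasure lebesgue {x. L2_set (weak_grad u x) (order_idx h) > t} < \<infinity>}"

subsection \<open>Campanato spaces\<close>

definition admissible :: "(real \<Rightarrow> real) \<Rightarrow> bool" where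
  "admissible \<phi> \<longleftrightarrow> (\<forall>r>0. \<phi> r > 0) \<and> (\<forall>a>0. (INF r\<in>{a..}. \<phi> r) > 0)"

definition mean_value :: "(real ^ 'n::finite) set \<Rightarrow> (real ^ 'n \<Rightarrow> real) \<Rightarrow> real" where
  "mean_value B u = (LINT x:B|lebesgue. u x) / measure lebesgue B"

definition campanato_seminorm ::
    "(real \<Rightarrow> real) \<Rightarrow> (real ^ 'n::finite \<Rightarrow> real) \<Rightarrow> ennreal" where
  "campanato_seminorm \<phi> u =
     Sup {ennreal (1 / \<phi> (measure lebesgue B powr (1 / real CARD('n))) *
            mean_value B (\<lambda>x. \<bar>u x - mean_value B u\<bar>)) |B. \<exists>x r. r > 0 \<and> B = ball x r}"

definition campanato_space ::
    "(real \<Rightarrow> real) \<Rightarrow> (real ^ 'n::finite \<Rightarrow> real) set" where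
  "campanato_space \<phi> = {u. locally_integrable u \<and> campanato_seminorm \<phi> u < \<infinity>}"

definition continuously_embedded ::
    "('f \<Rightarrow> ennreal) \<Rightarrow> 'f set \<Rightarrow> ('f \<Rightarrow> ennreal) \<Rightarrow> 'f set \<Rightarrow> bool" where
  "continuously_embedded p X q Y \<longleftrightarrow> X \<subseteq> Y \<and> (\<exists>c::real. \<forall>u\<in>X. q u \<le> ennreal c * p u)"

subsection \<open>Powers of extended nonnegative reals\<close>

text \<open>Only meant for exponents \<open>p > 0\<close>, where \<open>0\<^sup>p = 0\<close> and \<open>\<infinity>\<^sup>p = \<infinity>\<close>.\<close>

definition ennreal_powr :: "ennreal \<Rightarrow> real \<Rightarrow> ennreal" where
  "ennreal_powr x p = (if x = \<infinity> then \<infinity> else ennreal (enn2real x powr p))"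

end

theory Submission
  imports Defs
begin

text \<open>
  Let \<open>\<eta>(x) = x\<^sub>1 \<beta>(x)\<close> with a smooth bump \<open>\<beta> \<ge> 0\<close>, and superpose dilates of \<open>\<eta>\<close>: for \<open>t\<^sub>k \<ge> 0\<close> put
  \<open>u(x) = \<Sum> t\<^sub>k R\<^sup>s \<eta>(x / R)\<close> with \<open>R = 2\<^sup>k\<close>, \<open>k < N\<close>. The difference quotient of order \<open>{s}\<close> of
  \<open>\<nabla>\<^bsup>[s]\<^esup> u\<close> is at most \<open>\<Sum> t\<^sub>k H\<^sub>k\<close>, where \<open>\<Sum> H\<^sub>k\<close> is bounded uniformly in \<open>N\<close> (the quotient of a bounded
  Lipschitz function is at most \<open>min(1, r) / r\<^bsup>{s}\<^esup>\<close> with \<open>r = |x - y| / R\<close>, and these form two geometric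
  series) and \<open>\<integral>\<integral> H\<^sub>k |x - y|\<^sup>-\<^sup>n dx dy \<le> C 2\<^bsup>k n\<^esup>\<close>. Applying Jensen's inequality with the weights \<open>H\<^sub>k / D\<close> gives
  \<open>J(\<nabla>\<^bsup>[s]\<^esup> u / D) \<le> \<Sum> 2\<^bsup>k n\<^esup> A(t\<^sub>k)\<close>. On the other hand, testing against \<open>x\<^sub>1\<close> shows that the mean oscillation of
  \<open>u\<close> over the unit ball is at least \<open>q \<Sum> 2\<^bsup>k (s - 1)\<^esup> t\<^sub>k\<close>. So the embedding bounds \<open>\<Sum> 2\<^bsup>k (s - 1)\<^esup> t\<^sub>k\<close> whenever
  \<open>\<Sum> 2\<^bsup>k n\<^esup> A(t\<^sub>k) \<le> 1\<close>, and Orlicz duality turns this into the two assertions.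
\<close>

section \<open>Smooth functions\<close>

text \<open>The factor R^s is forced by scaling: [s] derivatives leave R^frac(s), which matches the
  |x - y|^frac(s) of the quotient, so a bump costs only its volume times A(t_k), while on the unit
  ball it equals R^(s-1) x_1 times a factor bounded below. Only R >= 1 occurs because the condition
  concerns A near 0, and wide bumps can afford only small t_k. Working on one fixed ball turns
  \<phi> into a constant. The obstacle is that A satisfies no doubling condition and may be
  infinite: A of a sum cannot be split at the price of constants outside A. Every constant has to go
  into D, inside A, and this is why the kernels need a sum bounded independently of N. A second
  obstacle is that the weak gradient is an arbitrary choice among representatives. Before the
  seminorm of u can be estimated, that choice must be identified almost everywhere with the
  classical gradient, which takes enough bump functions to separate locally integrable
  functions.\<close>

definition smooth :: "(real ^ 'n::finite \<Rightarrow> real) \<Rightarrow> bool" where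
  "smooth f \<longleftrightarrow> (\<forall>ds. iter_partial ds f differentiable_on UNIV)"

text \<open>Peels off the derivative that is applied first. Since the recursion varies
  \<open>f\<close>, closure under products and compositions becomes an induction on
  \<open>k\<close>, although the product rule leads to new functions at each order.\<close>

primrec k_diff :: "nat \<Rightarrow> (real ^ 'n::finite \<Rightarrow> real) \<Rightarrow> bool" where
  "k_diff 0 f \<longleftrightarrow> f differentiable_on UNIV"
| "k_diff (Suc k) f \<longleftrightarrow> f differentiable_on UNIV \<and> (\<forall>i. k_diff k (partial_deriv i f))"

lemma iter_partial_Nil [simp]: "iter_partial [] f = f"
  and iter_partial_Cons: "iter_partial (d # ds) f = partial_deriv d (iter_partial ds f)"
  and iter_partial_append: "iter_partial (ds @ es) f = iter_partial ds (iter_partial es f)"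
  by (simp_all add: iter_partial_def)

lemma k_diff_iff:
  "k_diff k f \<longleftrightarrow> (\<forall>ds. length ds \<le> k \<longrightarrow> iter_partial ds f differentiable_on UNIV)"
proof (induction k arbitrary: f)
  case (Suc k)
  show ?case
  proof
    assume "k_diff (Suc k) f"
    then have *: "f differentiable_on UNIV"
      by simp
    have **: "iter_partial ds (partial_deriv i f) differentiable_on UNIV" if "length ds \<le> k" for i ds
      using Suc.IH \<open>k_diff (Suc k) f\<close> that by auto
    show "\<forall>ds. length ds \<le> Suc k \<longrightarrow> iter_partial ds f differentiable_on UNIV"
    proof (intro allI impI)
      fix ds :: "'a list"
      assume l: "length ds \<le> Suc k"
      show "iter_partial ds f differentiable_on UNIV"
      \<comment> \<open>The last entry of a list is the derivative taken first, so the split that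
        matches the recursion of \<open>k_diff\<close> is at the end.\<close>
      proof (cases ds rule: rev_cases)
        case (snoc es d)
        then show ?thesis
          using **[of es d] l by (simp add: iter_partial_append iter_partial_Cons)
      qed (simp add: *)
    qed
  next
    assume R: "\<forall>ds. length ds \<le> Suc k \<longrightarrow> iter_partial ds f differentiable_on UNIV"
    have "f differentiable_on UNIV"
      using R[rule_format, of "[]"] by simp
    moreover have "iter_partial ds (partial_deriv i f) differentiable_on UNIV" if "length ds \<le> k" for i ds
      using R[rule_format, of "ds @ [i]"] that by (simp add: iter_partial_append iter_partial_Cons)
    ultimately show "k_diff (Suc k) f"
      using Suc by auto
  qed
qed simp

lemma smooth_iff_k_diff: "smooth f \<longleftrightarrow> (\<forall>k. k_diff k f)"
  unfolding smooth_def k_diff_iff by blast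

lemma k_diff_SucD: "k_diff (Suc k) f \<Longrightarrow> k_diff k f"
  unfolding k_diff_iff by auto

lemma k_diff_differentiable: "k_diff k f \<Longrightarrow> f differentiable_on UNIV"
  by (cases k) auto

lemma differentiable_on_UNIV_D:
  fixes f :: "real ^ 'n::finite \<Rightarrow> real"
  shows "f differentiable_on UNIV \<Longrightarrow> (f has_derivative frechet_derivative f (at x)) (at x)"
  by (simp add: differentiable_on_def frechet_derivative_works)

lemma partial_deriv_eqI: "(f has_derivative f') (at x) \<Longrightarrow> partial_deriv i f x = f' (axis i 1)"
  unfolding partial_deriv_def by (metis frechet_derivative_at)

lemma partial_deriv_add:
  assumes "f differentiable_on UNIV" "g differentiable_on UNIV"
  shows "partial_deriv i (\<lambda>x. f x + g x) = (\<lambda>x. partial_deriv i f x + partial_deriv i g x)"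
proof
  fix x
  show "partial_deriv i (\<lambda>x. f x + g x) x = partial_deriv i f x + partial_deriv i g x"
    using partial_deriv_eqI[OF has_derivative_add[OF assms[THEN differentiable_on_UNIV_D]], of i x]
    by (simp add: partial_deriv_def)
qed

lemma partial_deriv_mult:
  assumes "f differentiable_on UNIV" "g differentiable_on UNIV"
  shows "partial_deriv i (\<lambda>x. f x * g x) =
    (\<lambda>x. f x * partial_deriv i g x + partial_deriv i f x * g x)"
proof
  fix x
  show "partial_deriv i (\<lambda>x. f x * g x) x = f x * partial_deriv i g x + partial_deriv i f x * g x"
    using partial_deriv_eqI[OF has_derivative_mult[OF assms[THEN differentiable_on_UNIV_D]], of i x]
    by (simp add: partial_deriv_def)
qed

lemma partial_deriv_const: "partial_deriv i (\<lambda>x. c) = (\<lambda>x. 0)"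
  by (simp add: fun_eq_iff partial_deriv_eqI[OF has_derivative_const])

lemma partial_deriv_nth: "partial_deriv i (\<lambda>x. x $ j) = (\<lambda>x. axis i 1 $ j)"
proof
  fix x :: "real ^ 'a"
  have "((\<lambda>x. x $ j) has_derivative (\<lambda>x. x $ j)) (at x)"
    by (rule bounded_linear_imp_has_derivative[OF bounded_linear_vec_nth])
  then show "partial_deriv i (\<lambda>x. x $ j) x = axis i 1 $ j"
    by (rule partial_deriv_eqI)
qed

lemma partial_deriv_compose:
  assumes "\<And>t. (E has_real_derivative E' t) (at t)" "f differentiable_on UNIV"
  shows "partial_deriv i (\<lambda>x. E (f x)) = (\<lambda>x. E' (f x) * partial_deriv i f x)"
    and "(\<lambda>x. E (f x)) differentiable_on UNIV"
proof -
  have d: "((\<lambda>x. E (f x)) has_derivative (\<lambda>h. frechet_derivative f (at x) h * E' (f x))) (at x)" for x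
    by (rule has_derivative_eq_rhs[OF has_derivative_compose[OF differentiable_on_UNIV_D[OF assms(2)]
      assms(1)[unfolded has_field_derivative_def]]]) (simp add: mult.commute)
  show "partial_deriv i (\<lambda>x. E (f x)) = (\<lambda>x. E' (f x) * partial_deriv i f x)"
    using partial_deriv_eqI[OF d] by (simp add: fun_eq_iff partial_deriv_def)
  show "(\<lambda>x. E (f x)) differentiable_on UNIV"
    using d by (auto simp: differentiable_on_def differentiable_def)
qed

lemma k_diff_const: "k_diff k (\<lambda>x. c)"
  by (induction k arbitrary: c) (simp_all add: partial_deriv_const)

lemma differentiable_on_nth: "(\<lambda>x::real ^ 'n::finite. x $ j) differentiable_on UNIV"
  using bounded_linear_imp_differentiable_on[OF bounded_linear_vec_nth] by blast

lemma k_diff_nth: "k_diff k (\<lambda>x. x $ j)"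
  by (cases k) (simp_all add: partial_deriv_nth k_diff_const differentiable_on_nth)

lemma k_diff_add: "k_diff k f \<Longrightarrow> k_diff k g \<Longrightarrow> k_diff k (\<lambda>x. f x + g x)"
  by (induction k arbitrary: f g) (auto simp: partial_deriv_add)

lemma k_diff_mult: "k_diff k f \<Longrightarrow> k_diff k g \<Longrightarrow> k_diff k (\<lambda>x. f x * g x)"
proof (induction k arbitrary: f g)
  case (Suc k)
  then have "k_diff k f" "k_diff k g"
    by (auto intro: k_diff_SucD simp del: k_diff.simps)
  with Suc show ?case
    by (auto simp: partial_deriv_mult intro!: k_diff_add)
qed auto

text \<open>\<open>E\<close> is the sequence of successive derivatives of \<open>E 0\<close>. The
  index \<open>j\<close> is generalised because one differentiation of \<open>E j (f x)\<close>
  produces \<open>E (Suc j) (f x)\<close> times a derivative of \<open>f\<close>.\<close>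

lemma k_diff_compose:
  assumes E: "\<And>j t. (E j has_real_derivative E (Suc j) t) (at t)"
  shows "k_diff k f \<Longrightarrow> k_diff k (\<lambda>x. E j (f x))"
proof (induction k arbitrary: j)
  case 0
  then show ?case
    using partial_deriv_compose(2)[OF E] by simp
next
  case (Suc k)
  then have "k_diff k f" "f differentiable_on UNIV"
    by (auto intro: k_diff_SucD simp del: k_diff.simps dest: k_diff_differentiable)
  then show ?case
    using Suc.IH[of "Suc j"] Suc.prems
    by (auto simp: partial_deriv_compose(1)[OF E] partial_deriv_compose(2)[OF E, of f j]
        intro!: k_diff_mult)
qed

lemma smooth_const: "smooth (\<lambda>x. c)"
  and smooth_nth: "smooth (\<lambda>x. x $ j)"
  and smooth_add: "smooth f \<Longrightarrow> smooth g \<Longrightarrow> smooth (\<lambda>x. f x + g x)"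
  and smooth_mult: "smooth f \<Longrightarrow> smooth g \<Longrightarrow> smooth (\<lambda>x. f x * g x)"
  unfolding smooth_iff_k_diff by (simp_all add: k_diff_const k_diff_nth k_diff_add k_diff_mult)

lemma smooth_prod: "finite I \<Longrightarrow> (\<And>i. i \<in> I \<Longrightarrow> smooth (f i)) \<Longrightarrow> smooth (\<lambda>x. \<Prod>i\<in>I. f i x)"
  by (induction I rule: finite_induct) (auto simp: smooth_const intro!: smooth_mult)

lemma smooth_compose:
  assumes "\<And>j t. (E j has_real_derivative E (Suc j) t) (at t)" "smooth f"
  shows "smooth (\<lambda>x. E 0 (f x))"
  using assms(2) k_diff_compose[of E _ f 0, OF assms(1)] unfolding smooth_iff_k_diff by blast

lemma smooth_iter_partial: "smooth f \<Longrightarrow> smooth (iter_partial ds f)"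
  unfolding smooth_def by (metis iter_partial_append)

lemma smooth_differentiable: "smooth f \<Longrightarrow> f differentiable_on UNIV"
  unfolding smooth_def by (metis iter_partial_Nil)

lemma smooth_partial_deriv: "smooth f \<Longrightarrow> smooth (partial_deriv d f)"
  using smooth_iter_partial[of f "[d]"] by (simp add: iter_partial_Cons)

lemma smooth_continuous: "smooth f \<Longrightarrow> continuous_on S f"
  using smooth_differentiable continuous_on_subset differentiable_imp_continuous_on by blast

lemma iter_partial_sum_scaled:
  fixes f :: "real ^ 'n::finite \<Rightarrow> real"
  assumes "smooth f"
  shows "iter_partial ds (\<lambda>x. \<Sum>k\<in>I. c k * f (r k *\<^sub>R x)) =
    (\<lambda>x. \<Sum>k\<in>I. c k * r k ^ length ds * iter_partial ds f (r k *\<^sub>R x))"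
    and "(\<lambda>x. \<Sum>k\<in>I. c k * f (r k *\<^sub>R x)) differentiable_on UNIV"
proof -
  have der: "((\<lambda>x. \<Sum>k\<in>I. c k * g (r k *\<^sub>R x)) has_derivative
      (\<lambda>h. \<Sum>k\<in>I. c k * frechet_derivative g (at (r k *\<^sub>R x)) (r k *\<^sub>R h))) (at x)"
    if "smooth g" for x c and g :: "real ^ 'n \<Rightarrow> real"
    by (intro has_derivative_sum has_derivative_mult_right
        has_derivative_compose[OF _ differentiable_on_UNIV_D[OF smooth_differentiable[OF that]]]
        has_derivative_scaleR_right has_derivative_ident)
  show "(\<lambda>x. \<Sum>k\<in>I. c k * f (r k *\<^sub>R x)) differentiable_on UNIV"
    using der[OF assms] by (auto simp: differentiable_on_def differentiable_def)
  show "iter_partial ds (\<lambda>x. \<Sum>k\<in>I. c k * f (r k *\<^sub>R x)) =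
    (\<lambda>x. \<Sum>k\<in>I. c k * r k ^ length ds * iter_partial ds f (r k *\<^sub>R x))"
  proof (induction ds)
    case (Cons d ds)
    have g: "smooth (iter_partial ds f)"
      using assms by (rule smooth_iter_partial)
    have "linear (frechet_derivative (iter_partial ds f) (at y))" for y
      by (rule has_derivative_linear[OF differentiable_on_UNIV_D[OF smooth_differentiable[OF g]]])
    then have "frechet_derivative (iter_partial ds f) (at y) (a *\<^sub>R h) =
        a * frechet_derivative (iter_partial ds f) (at y) h" for a y h
      by (simp add: linear_scale)
    then have "partial_deriv d (\<lambda>x. \<Sum>k\<in>I. c k * r k ^ length ds * iter_partial ds f (r k *\<^sub>R x)) x =
        (\<Sum>k\<in>I. c k * r k ^ length (d # ds) * partial_deriv d (iter_partial ds f) (r k *\<^sub>R x))" for x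
      by (subst partial_deriv_eqI[OF der[OF g]]) (simp add: partial_deriv_def mult_ac)
    then show ?case
      by (simp add: iter_partial_Cons Cons)
  qed simp
qed

lemma smooth_sum_scaled:
  assumes "smooth f"
  shows "smooth (\<lambda>x. \<Sum>k\<in>I. c k * f (r k *\<^sub>R x))"
  unfolding smooth_def iter_partial_sum_scaled(1)[OF assms]
  by (intro allI iter_partial_sum_scaled(2) smooth_iter_partial assms)

subsection \<open>Bump functions\<close>

text \<open>The classical smooth function all of whose derivatives vanish at 0.\<close>

definition flat_exp :: "real \<Rightarrow> real" where
  "flat_exp t = (if t \<le> 0 then 0 else exp (- (1 / t)))"

lemma poly_times_exp_minus_tendsto_0:
  "((\<lambda>y::real. poly p y * exp (- y)) \<longlongrightarrow> 0) at_top"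
proof -
  have "((\<lambda>y::real. \<Sum>i\<le>degree p. coeff p i * (y ^ i / exp y)) \<longlongrightarrow> (\<Sum>i\<le>degree p. coeff p i * 0)) at_top"
    by (intro tendsto_intros tendsto_power_div_exp_0)
  then show ?thesis
    by (simp add: poly_altdef exp_minus sum_distrib_left divide_inverse mult_ac)
qed

lemma flat_exp_derivatives:
  obtains E where "E 0 = flat_exp" "\<And>j t. (E j has_real_derivative E (Suc j) t) (at t)"
proof
  \<comment> \<open>With y = 1/t, the derivative of p(y) exp(-y) in t is y^2 (p - p')(y) exp(-y);
    the polynomial \<open>[:0, 0, 1:]\<close> is y^2.\<close>
  define P :: "nat \<Rightarrow> real poly" where "P j = ((\<lambda>p. [:0, 0, 1:] * (p - pderiv p)) ^^ j) 1" for j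
  define E where "E j t = (if t \<le> 0 then 0 else poly (P j) (1 / t) * exp (- (1 / t)))" for j and t :: real
  show "E 0 = flat_exp"
    by (auto simp: E_def flat_exp_def P_def)
  show "(E j has_real_derivative E (Suc j) t) (at t)" for j t
  proof -
    consider "t < 0" | "t = 0" | "t > 0" by linarith
    then show ?thesis
    proof cases
      case 1
      then have "((\<lambda>_. 0) has_real_derivative E (Suc j) t) (at t)"
        by (simp add: E_def)
      then show ?thesis
        by (rule has_field_derivative_transform_within_open[of _ _ _ "{..<0}"]) (use 1 in \<open>auto simp: E_def\<close>)
    next
      case 3
      have "((\<lambda>t. poly (P j) (1 / t) * exp (- (1 / t))) has_real_derivative E (Suc j) t) (at t)"
        using 3 by (auto intro!: derivative_eq_intros DERIV_chain'[OF _ poly_DERIV]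
            simp: E_def P_def field_simps power2_eq_square)
      then show ?thesis
        by (rule has_field_derivative_transform_within_open[of _ _ _ "{0<..}"]) (use 3 in \<open>auto simp: E_def\<close>)
    next
      case 2
      \<comment> \<open>The extra factor \<open>[:0, 1:]\<close> is the 1/h of the difference
        quotient at 0, so the quotient is again a polynomial in 1/h times exp(-1/h).\<close>
      have "((\<lambda>h. poly ([:0, 1:] * P j) (1 / h) * exp (- (1 / h))) \<longlongrightarrow> 0) (at_right 0)"
        using filterlim_compose[OF poly_times_exp_minus_tendsto_0 filterlim_inverse_at_top_right]
        unfolding inverse_eq_divide .
      then have "((\<lambda>h. E j h / h) \<longlongrightarrow> 0) (at_right 0)"
        by (rule Lim_transform_eventually)
          (auto simp: E_def eventually_at_right_field intro!: exI[of _ 1])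
      moreover have "((\<lambda>h. E j h / h) \<longlongrightarrow> 0) (at_left 0)"
        by (rule tendsto_eventually) (auto simp: E_def eventually_at_left_field intro!: exI[of _ "-1"])
      ultimately have "((\<lambda>h. E j h / h) \<longlongrightarrow> 0) (at 0)"
        by (simp add: filterlim_at_split)
      then show ?thesis
        using 2 by (simp add: has_field_derivative_iff E_def)
    qed
  qed
qed

lemma smooth_flat_exp: "smooth f \<Longrightarrow> smooth (\<lambda>x. flat_exp (f x))"
  by (metis flat_exp_derivatives smooth_compose)

lemma flat_exp_nonneg: "0 \<le> flat_exp t"
  and flat_exp_le_1: "flat_exp t \<le> 1"
  and flat_exp_eq_0_iff: "flat_exp t = 0 \<longleftrightarrow> t \<le> 0"
  by (auto simp: flat_exp_def)

text \<open>The steepness \<open>j\<close> gives one family two uses: a fixed cut-off for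
  \<open>j = 1\<close>, and an approximation of the indicator of the open box as \<open>j\<close>
  grows.\<close>

definition box_bump :: "real \<Rightarrow> real ^ 'n::finite \<Rightarrow> real ^ 'n \<Rightarrow> real ^ 'n \<Rightarrow> real" where
  "box_bump j a b x = (\<Prod>i\<in>UNIV. flat_exp (j * (x $ i - a $ i)) * flat_exp (j * (b $ i - x $ i)))"

lemma smooth_box_bump: "smooth (box_bump j a b)"
proof -
  have "smooth (\<lambda>x. j * (x $ i + (- (a $ i))))" "smooth (\<lambda>x. j * (b $ i + (- 1) * x $ i))" for i
    by (intro smooth_mult smooth_add smooth_const smooth_nth)+
  then have "smooth (\<lambda>x. j * (x $ i - a $ i))" "smooth (\<lambda>x. j * (b $ i - x $ i))" for i
    by simp_all
  then show ?thesis
    unfolding box_bump_def by (intro smooth_prod smooth_mult[OF smooth_flat_exp smooth_flat_exp]) auto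
qed

lemma box_bump_nonneg: "0 \<le> box_bump j a b x"
  by (auto simp: box_bump_def intro!: prod_nonneg flat_exp_nonneg mult_nonneg_nonneg)

lemma box_bump_le_1: "box_bump j a b x \<le> 1"
  unfolding box_bump_def by (intro prod_le_1 conjI mult_le_one mult_nonneg_nonneg flat_exp_nonneg flat_exp_le_1)

lemma box_bump_eq_0_iff:
  assumes "j > 0"
  shows "box_bump j a b x = 0 \<longleftrightarrow> x \<notin> box a b"
  using assms by (auto simp: box_bump_def mem_box_cart flat_exp_eq_0_iff mult_le_0_iff not_less)

lemma box_bump_tendsto: "(\<lambda>j. box_bump (real (Suc j)) a b x) \<longlonglongrightarrow> indicator (box a b) x"
proof (cases "x \<in> box a b")
  case True
  have "(\<lambda>j. flat_exp (real (Suc j) * t)) \<longlonglongrightarrow> 1" if "t > 0" for t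
  proof -
    have "(\<lambda>j. exp (- (inverse (real (Suc j)) * (1 / t)))) \<longlonglongrightarrow> exp (- (0 * (1 / t)))"
      by (intro tendsto_intros LIMSEQ_inverse_real_of_nat)
    moreover have "flat_exp (real (Suc j) * t) = exp (- (inverse (real (Suc j)) * (1 / t)))" for j
      using that by (simp add: flat_exp_def mult_le_0_iff not_le divide_inverse del: of_nat_Suc)
    ultimately show ?thesis
      by simp
  qed
  then have "(\<lambda>j. box_bump (real (Suc j)) a b x) \<longlonglongrightarrow> (\<Prod>i\<in>(UNIV::'a set). 1 * 1)"
    unfolding box_bump_def using True by (intro tendsto_prod tendsto_mult) (auto simp: mem_box_cart)
  then show ?thesis
    using True by simp
next
  case False
  then show ?thesis
    using box_bump_eq_0_iff[of "real (Suc _)" a b x] by simp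
qed

lemma test_function_box_bump: "j > 0 \<Longrightarrow> test_function (box_bump j a b)"
  using smooth_box_bump[of j a b] bounded_subset[OF bounded_box[of a b], of "{x. box_bump j a b x \<noteq> 0}"]
  by (auto simp: test_function_def smooth_def box_bump_eq_0_iff)

section \<open>Weak derivatives of test functions\<close>

lemma test_function_iff: "test_function f \<longleftrightarrow> smooth f \<and> bounded {x. f x \<noteq> 0}"
  by (simp add: test_function_def smooth_def)

lemma partial_deriv_support:
  assumes "closed C" "{x. f x \<noteq> 0} \<subseteq> C"
  shows "{x. partial_deriv d f x \<noteq> 0} \<subseteq> C"
proof -
  have "partial_deriv d f x = 0" if "x \<notin> C" for x
  proof -
    have "((\<lambda>x. 0) has_derivative (\<lambda>h. 0)) (at x)"
      by (rule has_derivative_const)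
    then have "(f has_derivative (\<lambda>h. 0)) (at x)"
      by (rule has_derivative_transform_within_open[of _ _ _ _ "- C"])
        (use assms that in auto)
    then show ?thesis
      by (rule partial_deriv_eqI[of f "\<lambda>h. 0", simplified])
  qed
  then show ?thesis
    by auto
qed

lemma iter_partial_support:
  assumes "closed C" "{x. f x \<noteq> 0} \<subseteq> C"
  shows "{x. iter_partial ds f x \<noteq> 0} \<subseteq> C"
  by (induction ds) (use assms partial_deriv_support[OF assms(1)] in \<open>auto simp: iter_partial_Cons\<close>)

lemma bounded_support_cball:
  fixes f :: "'a::real_normed_vector \<Rightarrow> real"
  assumes "bounded {x. f x \<noteq> 0}"
  obtains R where "R > 0" "{x. f x \<noteq> 0} \<subseteq> cball 0 R"
  using assms bounded_pos[of "{x. f x \<noteq> 0}"] by (auto simp: subset_eq)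

lemma test_function_iter_partial: "test_function f \<Longrightarrow> test_function (iter_partial ds f)"
  unfolding test_function_iff
  by (metis bounded_support_cball iter_partial_support closed_cball bounded_cball bounded_subset
      smooth_iter_partial)

lemma test_function_partial_deriv: "test_function f \<Longrightarrow> test_function (partial_deriv d f)"
  using test_function_iter_partial[of f "[d]"] by (simp add: iter_partial_Cons)

lemma integrable_continuous_bounded_support:
  fixes f :: "'a::euclidean_space \<Rightarrow> real"
  assumes "continuous_on UNIV f" "bounded {x. f x \<noteq> 0}"
  shows "integrable lborel f"
proof -
  obtain R where "{x. f x \<noteq> 0} \<subseteq> cball 0 R"
    using bounded_support_cball[OF assms(2)] by blast
  then have "f = (\<lambda>x. indicator (cball 0 R) x *\<^sub>R f x)"
    by (auto simp: fun_eq_iff indicator_def)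
  then show ?thesis
    using borel_integrable_compact[of "cball 0 R" f] continuous_on_subset[OF assms(1)]
    by (metis compact_cball subset_UNIV)
qed

lemma continuous_bounded_support_bounded:
  fixes f :: "'a::euclidean_space \<Rightarrow> real"
  assumes "continuous_on UNIV f" "bounded {x. f x \<noteq> 0}"
  obtains M where "M > 0" "\<And>x. \<bar>f x\<bar> \<le> M"
proof -
  obtain R where R: "R > 0" "{x. f x \<noteq> 0} \<subseteq> cball 0 R"
    using bounded_support_cball[OF assms(2)] by blast
  have "bounded (f ` cball 0 R)"
    by (intro compact_imp_bounded compact_continuous_image continuous_on_subset[OF assms(1)]) auto
  then obtain M where "M > 0" "\<And>x. x \<in> cball 0 R \<Longrightarrow> \<bar>f x\<bar> \<le> M"
    by (auto simp: bounded_pos)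
  moreover from this have "\<bar>f x\<bar> \<le> M" for x
    using R(2) by (cases "x \<in> cball 0 R") force+
  ultimately show ?thesis
    using that by blast
qed

lemma has_derivative_line:
  assumes "f differentiable_on UNIV"
  shows "((\<lambda>t. f (x + t *\<^sub>R axis d 1)) has_real_derivative
    partial_deriv d f (x + t *\<^sub>R axis d 1)) (at t)"
proof -
  have "((\<lambda>t. x + t *\<^sub>R axis d 1) has_derivative (\<lambda>h. h *\<^sub>R axis d 1)) (at t)"
    by (auto intro!: derivative_eq_intros)
  from has_derivative_compose[OF this differentiable_on_UNIV_D[OF assms]]
  show ?thesis
    unfolding has_field_derivative_def
    by (rule has_derivative_eq_rhs)
      (simp add: fun_eq_iff partial_deriv_def
        linear_scale[OF has_derivative_linear[OF differentiable_on_UNIV_D[OF assms]]])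
qed

text \<open>The difference quotients of \<open>f\<close> have vanishing integral by translation invariance.\<close>

lemma integral_partial_deriv_eq_0:
  fixes f :: "real ^ 'n::finite \<Rightarrow> real"
  assumes "test_function f"
  shows "(LINT x|lborel. partial_deriv d f x) = 0"
proof -
  let ?D = "partial_deriv d f" and ?e = "axis d 1 :: real ^ 'n"
  have f: "smooth f" "bounded {x. f x \<noteq> 0}" and D: "smooth ?D" "bounded {x. ?D x \<noteq> 0}"
    using assms test_function_partial_deriv by (auto simp: test_function_iff)
  have int_f: "integrable lborel f"
    using f by (intro integrable_continuous_bounded_support smooth_continuous)
  have meas: "f \<in> borel_measurable borel" "?D \<in> borel_measurable borel"
    using f D by (auto intro!: borel_measurable_continuous_onI smooth_continuous)
  note [measurable] = meas
  obtain M where M: "M > 0" "\<And>x. \<bar>?D x\<bar> \<le> M"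
    using continuous_bounded_support_bounded[OF smooth_continuous[OF D(1)] D(2)] by blast
  obtain R where R: "R > 0" "{x. f x \<noteq> 0} \<subseteq> cball 0 R"
    using bounded_support_cball[OF f(2)] by blast
  define \<epsilon> where "\<epsilon> k = inverse (real (Suc k))" for k
  have \<epsilon>: "\<epsilon> k > 0" "\<epsilon> k \<le> 1" for k
    by (auto simp: \<epsilon>_def divide_simps)
  define q where "q k x = (f (x + \<epsilon> k *\<^sub>R ?e) - f x) / \<epsilon> k" for k x
  have "(\<lambda>k. LINT x|lborel. q k x) \<longlonglongrightarrow> (LINT x|lborel. ?D x)"
  \<comment> \<open>The mean value theorem bounds the quotients by the bound \<open>M\<close> of the
    derivative, and steps of length at most 1 enlarge the support radius by at most 1.\<close>
  proof (rule integral_dominated_convergence[where w = "\<lambda>x. M * indicator (cball 0 (R + 1)) x"])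
    show "integrable lborel (\<lambda>x. M * indicator (cball 0 (R + 1)) x)"
      by (intro integrable_mult_right integrable_real_indicator)
        (use emeasure_lborel_cball_finite in \<open>auto simp: top.not_eq_extremum\<close>)
    show "AE x in lborel. (\<lambda>k. q k x) \<longlonglongrightarrow> ?D x"
    proof (rule AE_I2)
      fix x
      have lim: "filterlim \<epsilon> (at 0) sequentially"
        using LIMSEQ_inverse_real_of_nat \<epsilon>(1)
        by (auto simp: filterlim_at \<epsilon>_def[abs_def] eventually_sequentially intro!: exI[of _ 0])
      have "((\<lambda>h. (f (x + h *\<^sub>R ?e) - f x) / h) \<longlongrightarrow> ?D x) (at 0)"
        using has_derivative_line[OF smooth_differentiable[OF f(1)], of x d 0]
        by (simp add: has_field_derivative_iff)
      from filterlim_compose[OF this lim] show "(\<lambda>k. q k x) \<longlonglongrightarrow> ?D x"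
        by (simp add: q_def)
    qed
    show "AE x in lborel. norm (q k x) \<le> M * indicator (cball 0 (R + 1)) x" for k
    proof (rule AE_I2)
      fix x
      show "norm (q k x) \<le> M * indicator (cball 0 (R + 1)) x"
      proof (cases "x \<in> cball 0 (R + 1)")
        case True
        obtain z where "f (x + \<epsilon> k *\<^sub>R ?e) - f (x + 0 *\<^sub>R ?e) = (\<epsilon> k - 0) * ?D (x + z *\<^sub>R ?e)"
          using MVT2[OF \<epsilon>(1)[of k], where f = "\<lambda>t. f (x + t *\<^sub>R ?e)" and f' = "\<lambda>t. ?D (x + t *\<^sub>R ?e)"]
            has_derivative_line[OF smooth_differentiable[OF f(1)]] by blast
        then have "q k x = ?D (x + z *\<^sub>R ?e)"
          using \<epsilon>(1)[of k] by (simp add: q_def)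
        then show ?thesis
          using True M by simp
      next
        case False
        have "norm (x + \<epsilon> k *\<^sub>R ?e) \<ge> norm x - norm (\<epsilon> k *\<^sub>R ?e)"
          by (metis norm_diff_ineq)
        then have "norm (x + \<epsilon> k *\<^sub>R ?e) > R" "norm x > R"
          using False \<epsilon>[of k] by auto
        then have "f (x + \<epsilon> k *\<^sub>R ?e) = 0" "f x = 0"
          using R(2) by force+
        then show ?thesis
          using M(1) by (simp add: q_def)
      qed
    qed
  qed (auto simp: q_def)
  moreover have "(LINT x|lborel. q k x) = 0" for k
  proof -
    let ?c = "\<epsilon> k *\<^sub>R ?e"
    have d: "distr lborel borel ((+) ?c) = lborel"
      by (rule lborel_distr_plus)
    have "(LINT x|lborel. f (?c + x)) = (LINT x|lborel. f x)"
      using integral_distr[of "(+) ?c" lborel borel f] d by simp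
    moreover have "integrable lborel (\<lambda>x. f (?c + x))"
      using integrable_distr_eq[of "(+) ?c" lborel borel f] d int_f by simp
    ultimately show ?thesis
      unfolding q_def using int_f by (simp add: add.commute)
  qed
  ultimately show ?thesis
    by (simp add: LIMSEQ_const_iff)
qed

lemma smooth_borel_measurable:
  assumes "smooth f"
  shows "f \<in> borel_measurable borel" "f \<in> borel_measurable lborel" "f \<in> borel_measurable lebesgue"
proof -
  show *: "f \<in> borel_measurable borel"
    using assms by (intro borel_measurable_continuous_onI smooth_continuous)
  then show "f \<in> borel_measurable lborel"
    by simp
  with * show "f \<in> borel_measurable lebesgue"
    using measurable_completion by blast
qed

lemma integrable_mult_smooth:
  assumes "smooth f" "smooth g" "bounded {x. f x \<noteq> 0} \<or> bounded {x. g x \<noteq> 0}"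
  shows "integrable lborel (\<lambda>x. f x * g x)"
proof (rule integrable_continuous_bounded_support)
  show "continuous_on UNIV (\<lambda>x. f x * g x)"
    using assms by (intro continuous_intros smooth_continuous)
  show "bounded {x. f x * g x \<noteq> 0}"
    using assms(3) by (auto intro: bounded_subset)
qed

lemma integration_by_parts:
  assumes "smooth f" "smooth g" "bounded {x. g x \<noteq> 0}"
  shows "(LINT x|lborel. f x * partial_deriv d g x) = - (LINT x|lborel. partial_deriv d f x * g x)"
proof -
  have g': "bounded {x. partial_deriv d g x \<noteq> 0}"
    using test_function_partial_deriv[of g d] assms by (simp add: test_function_iff)
  have "test_function (\<lambda>x. f x * g x)"
    unfolding test_function_iff using assms by (auto intro: bounded_subset smooth_mult)
  from integral_partial_deriv_eq_0[OF this, of d]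
  have "(LINT x|lborel. f x * partial_deriv d g x + partial_deriv d f x * g x) = 0"
    using assms by (simp add: partial_deriv_mult smooth_differentiable)
  then show ?thesis
    using assms g' by (subst (asm) Bochner_Integration.integral_add)
      (auto intro!: integrable_mult_smooth smooth_partial_deriv)
qed

text \<open>Each integration by parts moves the outermost derivative of \<psi> onto
  \<open>f\<close>, where it becomes the innermost one, so the list arrives reversed. Keeping
  \<open>rev\<close> avoids any appeal to the symmetry of mixed derivatives.\<close>

lemma integral_iter_partial:
  assumes "smooth f" "test_function \<psi>"
  shows "(LINT x|lborel. f x * iter_partial ds \<psi> x) =
    (- 1) ^ length ds * (LINT x|lborel. iter_partial (rev ds) f x * \<psi> x)"
  using assms(1)
proof (induction ds arbitrary: f)
  case (Cons d ds)
  have "(LINT x|lborel. f x * iter_partial (d # ds) \<psi> x) =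
      - (LINT x|lborel. partial_deriv d f x * iter_partial ds \<psi> x)"
    using test_function_iter_partial[OF assms(2), of ds] Cons.prems
    by (simp add: iter_partial_Cons integration_by_parts test_function_iff)
  also have "\<dots> = (- 1) ^ length (d # ds) * (LINT x|lborel. iter_partial (rev ds) (partial_deriv d f) x * \<psi> x)"
    using Cons.IH[OF smooth_partial_deriv[OF Cons.prems]] by simp
  finally show ?case
    by (simp add: iter_partial_append iter_partial_Cons)
qed simp

lemma locally_integrable_continuous:
  assumes "continuous_on UNIV f"
  shows "locally_integrable f"
  unfolding locally_integrable_def set_integrable_def
proof (intro allI impI)
  fix K :: "(real ^ 'a) set"
  assume K: "compact K"
  have "integrable lborel (\<lambda>x. indicator K x *\<^sub>R f x)"
    using K assms by (intro borel_integrable_compact continuous_on_subset[OF assms]) auto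
  then show "integrable lebesgue (\<lambda>x. indicator K x *\<^sub>R f x)"
    by (subst integrable_completion) auto
qed

lemma has_weak_partial_smooth:
  assumes "smooth f"
  shows "has_weak_partial f ds (iter_partial (rev ds) f)"
  unfolding has_weak_partial_def
proof (intro conjI allI impI)
  show "locally_integrable f" "locally_integrable (iter_partial (rev ds) f)"
    using assms by (auto intro!: locally_integrable_continuous smooth_continuous smooth_iter_partial)
  fix \<psi> :: "real ^ 'a \<Rightarrow> real"
  assume \<psi>: "test_function \<psi>"
  have "(\<lambda>x. f x * iter_partial ds \<psi> x) \<in> borel_measurable lborel"
    "(\<lambda>x. iter_partial (rev ds) f x * \<psi> x) \<in> borel_measurable lborel"
    using assms \<psi> by (auto simp: test_function_iff simp del: measurable_lborel1 measurable_lborel2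
        intro!: borel_measurable_times[OF smooth_borel_measurable(2) smooth_borel_measurable(2)]
        smooth_iter_partial)
  then show "(LINT x|lebesgue. f x * iter_partial ds \<psi> x) =
      (- 1) ^ length ds * (LINT x|lebesgue. iter_partial (rev ds) f x * \<psi> x)"
    by (simp add: integral_completion integral_iter_partial[OF assms \<psi>])
qed

subsection \<open>Uniqueness of weak derivatives\<close>

text \<open>Dynkin's argument: open boxes form an intersection-stable generator of the Borel sets,
  and the vanishing total integral handles complements. A function with zero integral over every
  Borel set vanishes almost everywhere.\<close>

lemma AE_eq_0_if_box_integrals_eq_0:
  fixes f :: "'a::euclidean_space \<Rightarrow> real"
  assumes f: "integrable lborel f"
    and box: "\<And>a b. (LINT x:box a b|lborel. f x) = 0"
    and total: "(LINT x|lborel. f x) = 0"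
  shows "AE x in lborel. f x = 0"
proof (rule sigma_finite_measure.density_zero[OF lborel.sigma_finite_measure_axioms f])
  let ?E = "range (\<lambda>(a, b). box a b::'a set)"
  have meas: "f \<in> borel_measurable borel"
    using f by auto
  have Int_E: "Int_stable ?E"
    by (auto simp: Int_stable_def box_Int_box)
  have si: "set_integrable lborel A f" if "A \<in> sets borel" for A
    using f that unfolding set_integrable_def by (intro integrable_mult_indicator) auto
  fix A :: "'a set"
  assume "A \<in> sets lborel"
  then have A: "A \<in> sigma_sets UNIV ?E"
    by (simp add: borel_eq_box)
  have borel: "sigma_sets UNIV ?E = sets borel"
    by (simp add: borel_eq_box)
  have "?E \<subseteq> Pow UNIV"
    by auto
  from Int_E this A show "(LINT x:A|lborel. f x) = 0"
  proof (induction rule: sigma_sets_induct_disjoint)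
    case (basic A)
    then show ?case
      using box by auto
  next
    case empty
    then show ?case
      by (simp add: set_lebesgue_integral_def)
  next
    case (compl A)
    then have A: "A \<in> sets borel"
      using borel by simp
    have "(LINT x:UNIV - A|lborel. f x) = (LINT x|lborel. f x - indicator A x *\<^sub>R f x)"
      unfolding set_lebesgue_integral_def
      by (rule Bochner_Integration.integral_cong) (auto simp: indicator_def)
    also have "\<dots> = 0"
      using compl si[OF A] f total unfolding set_lebesgue_integral_def set_integrable_def
      by (subst Bochner_Integration.integral_diff) auto
    finally show ?case .
  next
    case (union A)
    then have "A i \<in> sets borel" for i
      using borel by blast
    moreover from this have "(\<Union>i. A i) \<in> sets borel"
      by blast
    ultimately show ?case
      using union lebesgue_integral_countable_add[of A lborel f] si
      by (auto simp: disjoint_family_on_def)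
  qed
qed

lemma locally_integrable_borel_measurable:
  assumes "locally_integrable (f :: real ^ 'n::finite \<Rightarrow> real)"
  shows "f \<in> borel_measurable lebesgue"
proof -
  have "(\<lambda>x. indicator (cball 0 (real k)) x *\<^sub>R f x) \<in> borel_measurable lebesgue" for k
    using assms unfolding locally_integrable_def set_integrable_def
    by (intro borel_measurable_integrable) auto
  moreover have "(\<lambda>k. indicator (cball 0 (real k)) x *\<^sub>R f x) \<longlonglongrightarrow> f x" for x
  proof -
    obtain m where "norm x \<le> real m"
      using real_arch_simple by blast
    then have "indicator (cball 0 (real k)) x *\<^sub>R f x = f x" if "k \<ge> m" for k
      using that by (auto simp: indicator_def)
    then show ?thesis
      by (intro tendsto_eventually) (auto simp: eventually_sequentially)
  qed
  ultimately show ?thesis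
    by (rule borel_measurable_LIMSEQ_real[rotated])
qed

text \<open>Box bumps converge boundedly to the indicator of a box, so vanishing against test
  functions gives vanishing integrals over all boxes.\<close>

lemma du_Bois_Reymond:
  fixes f :: "real ^ 'n::finite \<Rightarrow> real"
  assumes loc: "locally_integrable f"
    and zero: "\<And>\<psi>. test_function \<psi> \<Longrightarrow> (LINT x|lebesgue. f x * \<psi> x) = 0"
  shows "AE x in lebesgue. f x = 0"
proof -
  have fm [measurable]: "f \<in> borel_measurable lebesgue"
    using loc by (rule locally_integrable_borel_measurable)
  have box: "(LINT x:box a b|lebesgue. f x) = 0" for a b
  proof -
    have int: "integrable lebesgue (\<lambda>x. indicator (cbox a b) x *\<^sub>R \<bar>f x\<bar>)"
      using loc integrable_abs[of lebesgue "\<lambda>x. indicator (cbox a b) x *\<^sub>R f x"]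
      by (auto simp: locally_integrable_def set_integrable_def abs_mult)
    have "(\<lambda>j. LINT x|lebesgue. f x * box_bump (real (Suc j)) a b x) \<longlonglongrightarrow>
        (LINT x|lebesgue. f x * indicator (box a b) x)"
    proof (rule integral_dominated_convergence[OF _ _ int])
      show "(\<lambda>x. f x * indicator (box a b) x) \<in> borel_measurable lebesgue"
        using fm by (intro borel_measurable_times borel_measurable_indicator) auto
      show "(\<lambda>x. f x * box_bump (real (Suc j)) a b x) \<in> borel_measurable lebesgue" for j
        by (rule borel_measurable_times[OF fm smooth_borel_measurable(3)[OF smooth_box_bump]])
      show "AE x in lebesgue. (\<lambda>j. f x * box_bump (real (Suc j)) a b x) \<longlonglongrightarrow> f x * indicator (box a b) x"
        by (intro AE_I2 tendsto_mult_left box_bump_tendsto)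
      show "AE x in lebesgue. norm (f x * box_bump (real (Suc j)) a b x) \<le> indicator (cbox a b) x *\<^sub>R \<bar>f x\<bar>" for j
      proof (rule AE_I2)
        fix x
        show "norm (f x * box_bump (real (Suc j)) a b x) \<le> indicator (cbox a b) x *\<^sub>R \<bar>f x\<bar>"
        proof (cases "x \<in> box a b")
          case True
          then have "x \<in> cbox a b"
            using box_subset_cbox by blast
          then show ?thesis
            using box_bump_nonneg[of "real (Suc j)" a b x] box_bump_le_1[of "real (Suc j)" a b x]
            by (simp add: abs_mult mult_left_le)
        next
          case False
          then have "box_bump (real (Suc j)) a b x = 0"
            by (subst box_bump_eq_0_iff) auto
          then show ?thesis
            by simp
        qed
      qed
    qed
    moreover have "(LINT x|lebesgue. f x * box_bump (real (Suc j)) a b x) = 0" for j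
      by (intro zero test_function_box_bump) simp
    ultimately show ?thesis
      by (simp add: LIMSEQ_const_iff set_lebesgue_integral_def mult.commute)
  qed
  \<comment> \<open>As \<open>f\<close> is only locally integrable, it is treated on an increasing
    sequence of boxes that exhausts the space.\<close>
  have "AE x in lebesgue. x \<in> box (- (real k *\<^sub>R One)) (real k *\<^sub>R One) \<longrightarrow> f x = 0" for k
  proof -
    let ?Q = "box (- (real k *\<^sub>R One)) (real k *\<^sub>R One) :: (real ^ 'n) set"
    let ?f = "\<lambda>x. indicator ?Q x *\<^sub>R f x"
    have "set_integrable lebesgue (cbox (- (real k *\<^sub>R One)) (real k *\<^sub>R One)) f"
      using loc by (auto simp: locally_integrable_def)
    then have int: "integrable lebesgue ?f"
      using set_integrable_subset[of lebesgue _ f ?Q] box_subset_cbox by (auto simp: set_integrable_def)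
    \<comment> \<open>The Dynkin argument runs over Borel sets for \<open>lborel\<close>, whereas
      \<open>f\<close> is only Lebesgue measurable; hence a Borel representative. Its integral over
      a box is that of \<open>f\<close> over the intersection with \<open>?Q\<close>, which is a box
      again.\<close>
    obtain g where g: "g \<in> borel_measurable lborel" and ae: "AE x in lborel. ?f x = g x"
      using completion_ex_borel_measurable_real[of ?f lborel] int by auto
    have ae': "AE x in lebesgue. ?f x = g x"
      using ae by (rule AE_completion)
    have [measurable]: "g \<in> borel_measurable lebesgue"
      using g by (rule measurable_completion)
    have int_g: "integrable lebesgue g"
      using int integrable_cong_AE[OF _ _ ae'] by auto
    have eq: "(LINT x:A|lborel. g x) = (LINT x:A \<inter> ?Q|lebesgue. f x)" if A: "A \<in> sets borel" for A
    proof -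
      have "(LINT x:A|lborel. g x) = (LINT x|lebesgue. indicator A x *\<^sub>R g x)"
        unfolding set_lebesgue_integral_def using g A by (intro integral_completion[symmetric]) auto
      also have "\<dots> = (LINT x|lebesgue. indicator A x *\<^sub>R ?f x)"
        using ae' A by (intro integral_cong_AE borel_measurable_scaleR borel_measurable_indicator fm) auto
      finally show ?thesis
        by (simp add: set_lebesgue_integral_def indicator_inter_arith mult.assoc)
    qed
    have "AE x in lborel. g x = 0"
    proof (rule AE_eq_0_if_box_integrals_eq_0)
      show "integrable lborel g"
        using int_g g by (simp add: integrable_completion)
      show "(LINT x:box a b|lborel. g x) = 0" for a b
        by (simp add: eq box_Int_box box)
      show "(LINT x|lborel. g x) = 0"
        using eq[of UNIV] box by (simp add: set_lebesgue_integral_def)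
    qed
    then have "AE x in lebesgue. g x = 0"
      by (rule AE_completion)
    with ae' show ?thesis
      by eventually_elim (auto simp: indicator_def)
  qed
  then have "AE x in lebesgue. \<forall>k. x \<in> box (- (real k *\<^sub>R One)) (real k *\<^sub>R One) \<longrightarrow> f x = 0"
    unfolding AE_all_countable by blast
  then show ?thesis
  proof eventually_elim
    case (elim x)
    have "x \<in> (\<Union>k::nat. box (- (real k *\<^sub>R One)) (real k *\<^sub>R One))"
      unfolding UN_box_eq_UNIV by simp
    with elim show ?case
      by blast
  qed
qed

lemma integrable_mult_test_function:
  assumes "locally_integrable g" "test_function \<psi>"
  shows "integrable lebesgue (\<lambda>x. g x * \<psi> x)"
proof -
  have \<psi>: "smooth \<psi>" "bounded {x. \<psi> x \<noteq> 0}"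
    using assms(2) by (auto simp: test_function_iff)
  obtain M where M: "M > 0" "\<And>x. \<bar>\<psi> x\<bar> \<le> M"
    using continuous_bounded_support_bounded[OF smooth_continuous[OF \<psi>(1)] \<psi>(2)] by blast
  obtain R where R: "{x. \<psi> x \<noteq> 0} \<subseteq> cball 0 R"
    using bounded_support_cball[OF \<psi>(2)] by blast
  have "set_integrable lebesgue (cball 0 R) g"
    using assms(1) by (simp add: locally_integrable_def)
  then have "integrable lebesgue (\<lambda>x. M * (indicator (cball 0 R) x *\<^sub>R g x))"
    unfolding set_integrable_def by (rule integrable_mult_right)
  then show ?thesis
  proof (rule Bochner_Integration.integrable_bound)
    show "(\<lambda>x. g x * \<psi> x) \<in> borel_measurable lebesgue"
      by (rule borel_measurable_times[OF locally_integrable_borel_measurable[OF assms(1)]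
            smooth_borel_measurable(3)[OF \<psi>(1)]])
    show "AE x in lebesgue. norm (g x * \<psi> x) \<le> norm (M * (indicator (cball 0 R) x *\<^sub>R g x))"
    proof (rule AE_I2)
      fix x
      show "norm (g x * \<psi> x) \<le> norm (M * (indicator (cball 0 R) x *\<^sub>R g x))"
      proof (cases "\<psi> x = 0")
        case False
        then show ?thesis
        proof -
          have "x \<in> cball 0 R"
            using False R by blast
          moreover have "\<bar>g x\<bar> * \<bar>\<psi> x\<bar> \<le> \<bar>g x\<bar> * \<bar>M\<bar>"
            using M(2)[of x] by (intro mult_left_mono) linarith+
          ultimately show ?thesis
            by (simp add: abs_mult mult.commute)
        qed
      qed simp
    qed
  qed
qed

lemma has_weak_partial_unique:
  assumes "has_weak_partial u ds g" "has_weak_partial u ds h"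
  shows "AE x in lebesgue. g x = h x"
proof -
  have gh: "locally_integrable g" "locally_integrable h"
    using assms by (auto simp: has_weak_partial_def)
  have "AE x in lebesgue. g x - h x = 0"
  proof (rule du_Bois_Reymond)
    show "locally_integrable (\<lambda>x. g x - h x)"
      using gh by (auto simp: locally_integrable_def intro: set_integral_diff)
    fix \<psi> :: "real ^ 'a \<Rightarrow> real"
    assume \<psi>: "test_function \<psi>"
    then have "(LINT x|lebesgue. g x * \<psi> x) = (LINT x|lebesgue. h x * \<psi> x)"
      using assms by (auto simp: has_weak_partial_def)
    then show "(LINT x|lebesgue. (g x - h x) * \<psi> x) = 0"
      using integrable_mult_test_function[OF gh(1) \<psi>] integrable_mult_test_function[OF gh(2) \<psi>]
      by (simp add: left_diff_distrib)
  qed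
  then show ?thesis
    by simp
qed

lemma weakly_differentiable_smooth: "smooth f \<Longrightarrow> weakly_differentiable m f"
  using has_weak_partial_smooth by (auto simp: weakly_differentiable_def)

text \<open>\<open>weak_partial\<close> is an unspecified representative; uniqueness up to null sets
  is what makes it computable.\<close>

lemma weak_partial_smooth:
  assumes "smooth f"
  shows "AE x in lebesgue. weak_partial ds f x = iter_partial (rev ds) f x"
proof (rule has_weak_partial_unique[OF _ has_weak_partial_smooth[OF assms]])
  show "has_weak_partial f ds (weak_partial ds f)"
    unfolding weak_partial_def by (rule someI[of "has_weak_partial f ds", OF has_weak_partial_smooth[OF assms]])
qed

lemma finite_order_idx: "finite (order_idx h :: 'n::finite list set)"
  using finite_lists_length_eq[of "UNIV :: 'n set" h] by (simp add: order_idx_def)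

lemma weak_grad_smooth:
  assumes "smooth f"
  shows "AE x in lebesgue. \<forall>ds\<in>order_idx h. weak_grad f x ds = iter_partial (rev ds) f x"
  unfolding weak_grad_def using weak_partial_smooth[OF assms] finite_order_idx
  by (intro AE_finite_allI) auto

section \<open>Young functions\<close>

lemma ex_power_interval:
  fixes r y :: real
  assumes "1 < r" "1 \<le> y"
  obtains k :: nat where "r ^ k \<le> y" "y < r ^ Suc k"
proof -
  obtain m where "y < r ^ m"
    using real_arch_pow[OF assms(1)] by blast
  then have ex: "\<exists>m. y < r ^ m" by blast
  define m where "m = (LEAST m. y < r ^ m)"
  have m: "y < r ^ m"
    using LeastI_ex[OF ex] by (simp add: m_def)
  then obtain k where k: "m = Suc k"
    using assms(2) by (cases m) auto
  then have "\<not> y < r ^ k"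
    unfolding m_def by (metis lessI not_less_Least)
  then show ?thesis
    using that[of k] m k by auto
qed

lemma young_function_0: "young_function A \<Longrightarrow> A 0 = 0"
  by (simp add: young_function_def)

lemma young_function_convex:
  assumes "young_function A" "0 \<le> x" "0 \<le> y" "0 \<le> \<theta>" "\<theta> \<le> 1"
  shows "A ((1 - \<theta>) * x + \<theta> * y) \<le> ennreal (1 - \<theta>) * A x + ennreal \<theta> * A y"
  using assms by (simp add: young_function_def)

lemma young_function_scale:
  assumes "young_function A" "0 \<le> t" "0 \<le> \<theta>" "\<theta> \<le> 1"
  shows "A (\<theta> * t) \<le> ennreal \<theta> * A t"
  using young_function_convex[OF assms(1) order_refl assms(2-4)] by (simp add: young_function_0[OF assms(1)])

lemma young_function_mono:
  assumes "young_function A" "0 \<le> x" "x \<le> y"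
  shows "A x \<le> A y"
proof (cases "y = 0")
  case False
  with assms have "A (x / y * y) \<le> ennreal (x / y) * A y"
    by (intro young_function_scale) (auto simp: field_simps)
  also have "\<dots> \<le> 1 * A y"
    using assms False by (intro mult_right_mono) (auto simp: divide_le_eq_1)
  finally show ?thesis
    using False by simp
qed (use assms in auto)

lemma young_function_finite_at:
  assumes "young_function A"
  obtains t where "t > 0" "A t < \<infinity>"
proof -
  have "\<not> A constant_on {0<..}"
    using assms by (simp add: young_function_def)
  then have "\<exists>t>0. A t \<noteq> \<infinity>"
    by (auto simp: constant_on_def)
  then show ?thesis
    using that by (auto simp: less_top)
qed

text \<open>Total weight below 1 is enough because the missing mass can be thought of as sitting at
  0, where \<open>A\<close> vanishes. This matters since the kernels used as weights have a bounded
  sum rather than a fixed one.\<close>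

lemma young_function_jensen:
  assumes A: "young_function A" and "finite I"
    and "\<And>i. i \<in> I \<Longrightarrow> 0 \<le> w i" "\<And>i. i \<in> I \<Longrightarrow> 0 \<le> t i" "(\<Sum>i\<in>I. w i) \<le> 1"
  shows "A (\<Sum>i\<in>I. w i * t i) \<le> (\<Sum>i\<in>I. ennreal (w i) * A (t i))"
  using assms(2-)
proof (induction I arbitrary: w rule: finite_induct)
  case empty
  then show ?case
    by (simp add: young_function_0[OF A])
next
  case (insert i I)
  have I: "0 \<le> (\<Sum>j\<in>I. w j)"
    using insert by (intro sum_nonneg) auto
  have sum_le: "w i + (\<Sum>j\<in>I. w j) \<le> 1"
    using insert by simp
  show ?case
  \<comment> \<open>The remaining weights are renormalised by \<open>1 - w i\<close>, so a weight
    that takes all the mass is set apart.\<close>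
  proof (cases "w i = 1")
    case True
    then have "(\<Sum>j\<in>I. w j) = 0"
      using sum_le I by linarith
    then have "\<forall>j\<in>I. w j = 0"
      using insert by (subst (asm) sum_nonneg_eq_0_iff) auto
    then show ?thesis
      using insert True by simp
  next
    case False
    then have wi: "0 \<le> w i" "w i < 1"
      using sum_le I insert by auto
    let ?y = "\<Sum>j\<in>I. w j / (1 - w i) * t j"
    have y: "0 \<le> ?y"
      using insert wi by (intro sum_nonneg mult_nonneg_nonneg divide_nonneg_nonneg) auto
    have le: "A ?y \<le> (\<Sum>j\<in>I. ennreal (w j / (1 - w i)) * A (t j))"
    proof (rule insert.IH)
      show "(\<Sum>j\<in>I. w j / (1 - w i)) \<le> 1"
        using wi sum_le by (simp add: sum_divide_distrib[symmetric])
    qed (use insert wi in auto)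
    have "(\<Sum>j\<in>insert i I. w j * t j) = (1 - w i) * ?y + w i * t i"
      using insert wi by (simp add: sum_distrib_left)
    then have "A (\<Sum>j\<in>insert i I. w j * t j) \<le> ennreal (1 - w i) * A ?y + ennreal (w i) * A (t i)"
      using young_function_convex[OF A y, of "t i" "w i"] insert.prems wi by (metis insertI1 less_imp_le)
    also have "\<dots> \<le> ennreal (1 - w i) * (\<Sum>j\<in>I. ennreal (w j / (1 - w i)) * A (t j)) + ennreal (w i) * A (t i)"
      by (intro add_right_mono mult_left_mono le) auto
    also have "ennreal (1 - w i) * (\<Sum>j\<in>I. ennreal (w j / (1 - w i)) * A (t j)) =
        (\<Sum>j\<in>I. ennreal (w j) * A (t j))"
      unfolding sum_distrib_left
    proof (rule sum.cong[OF refl])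
      fix j
      assume "j \<in> I"
      have "ennreal (1 - w i) * ennreal (w j / (1 - w i)) = ennreal (w j)"
        using wi insert \<open>j \<in> I\<close> by (subst ennreal_mult[symmetric]) auto
      then show "ennreal (1 - w i) * (ennreal (w j / (1 - w i)) * A (t j)) = ennreal (w j) * A (t j)"
        by (simp add: mult.assoc[symmetric])
    qed
    finally show ?thesis
      using insert by (simp add: add.commute)
  qed
qed

text \<open>The next two lemmas will be used with \<open>a = 2\<^sup>s\<^sup>-\<^sup>1\<close> and \<open>b = 2\<^sup>n\<close>.\<close>

lemma young_sequence_supercritical:
  assumes A: "young_function A" and ab: "1 \<le> b" "b < a"
  shows "\<exists>N t. (\<forall>k. 0 \<le> t k) \<and> (\<Sum>k<N. ennreal (b ^ k) * A (t k)) \<le> 1 \<and> M \<le> (\<Sum>k<N. a ^ k * t k)"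
proof -
  obtain t0 where t0: "t0 > 0" "A t0 < \<infinity>"
    using young_function_finite_at[OF A] by blast
  then obtain \<alpha> where \<alpha>: "A t0 = ennreal \<alpha>" "0 \<le> \<alpha>"
    by (cases "A t0") auto
  define \<beta> where "\<beta> = max 1 \<alpha>"
  have \<beta>: "\<beta> \<ge> 1" "\<alpha> \<le> \<beta>" by (auto simp: \<beta>_def)
  obtain K where K: "M * \<beta> / t0 < (a / b) ^ K"
    using real_arch_pow[of "a / b" "M * \<beta> / t0"] ab by auto
  have bK: "1 \<le> b ^ K"
    using ab by simp
  \<comment> \<open>A single scale suffices when \<open>b < a\<close>. Convexity gives A(t_K) \<le>
    A(t0) / (\<beta> b^K), so the cost is at most \<alpha> / \<beta> \<le> 1, while the gain (a/b)^K
    t0 / \<beta> exceeds \<open>M\<close> by the choice of \<open>K\<close>. Taking \<beta> \<ge> 1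
    keeps the scaling factor in [0,1].\<close>
  define t where "t k = (if k = K then 1 / (\<beta> * b ^ K) * t0 else 0)" for k
  have "1 * 1 \<le> \<beta> * b ^ K"
    using \<beta> bK by (intro mult_mono) auto
  then have "A (t K) \<le> ennreal (1 / (\<beta> * b ^ K)) * A t0"
    unfolding t_def using young_function_scale[OF A, of t0 "1 / (\<beta> * b ^ K)"] t0 by simp
  then have "ennreal (b ^ K) * A (t K) \<le> ennreal (b ^ K) * (ennreal (1 / (\<beta> * b ^ K)) * ennreal \<alpha>)"
    unfolding \<alpha> by (intro mult_left_mono) auto
  also have "\<dots> = ennreal (\<alpha> / \<beta>)"
    using \<beta> \<alpha> bK ab by (subst ennreal_mult[symmetric], simp, simp)+ simp
  also have "\<dots> \<le> 1"
    using \<beta> by simp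
  finally have le: "ennreal (b ^ K) * A (t K) \<le> 1" .
  have "(\<Sum>k<Suc K. ennreal (b ^ k) * A (t k)) = (\<Sum>k\<in>{K}. ennreal (b ^ k) * A (t k))"
    by (intro sum.mono_neutral_right) (auto simp: t_def young_function_0[OF A])
  then have "(\<Sum>k<Suc K. ennreal (b ^ k) * A (t k)) \<le> 1"
    using le by (simp del: sum.lessThan_Suc)
  moreover have "M \<le> (\<Sum>k<Suc K. a ^ k * t k)"
    using K \<beta> t0 bK by (simp add: t_def power_divide field_simps)
  moreover have "\<forall>k. 0 \<le> t k"
    using \<beta> bK t0 by (auto simp: t_def intro!: divide_nonneg_nonneg)
  ultimately show ?thesis
    by blast
qed

lemma suminf_ennreal_ge_1_eq_top:
  fixes f :: "nat \<Rightarrow> ennreal"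
  assumes "\<And>k. 1 \<le> f k"
  shows "(\<Sum>k. f k) = \<infinity>"
proof -
  have "of_nat n \<le> (\<Sum>k. f k)" for n
  proof -
    have "of_nat n = (\<Sum>k<n. 1 :: ennreal)"
      by simp
    also have "\<dots> \<le> (\<Sum>k<n. f k)"
      by (intro sum_mono assms)
    also have "\<dots> \<le> (\<Sum>k. f k)"
      by (rule sum_le_suminf) auto
    finally show ?thesis .
  qed
  then show ?thesis
    by (metis ennreal_Ex_less_of_nat infinity_ennreal_def less_top not_le)
qed

text \<open>
  The sequence is read off the level sets of \<open>A t / t\<close>: half the supremum of those \<open>t < 1\<close> with
  \<open>A t / t \<le> \<mu> (a / b)\<^sup>k\<close> makes \<open>b\<^sup>k A(t\<^sub>k) \<le> \<mu> a\<^sup>k t\<^sub>k\<close>, while \<open>\<Sum> a\<^sup>k t\<^sub>k\<close> is, up to constants, a layer-cake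
  sum for the divergent integral. Normalising \<open>\<mu> \<Sum> a\<^sup>k t\<^sub>k\<close> to 1 leaves \<open>\<Sum> a\<^sup>k t\<^sub>k = 1 / \<mu>\<close>, with
  \<open>\<mu>\<close> as small as we please.
\<close>

lemma young_sequence_divergent:
  assumes A: "young_function A" and ab: "1 < a" "a < b" and p: "0 < p" "(b / a) powr p = a"
    and div: "\<And>\<delta>. \<delta> > 0 \<Longrightarrow> (\<integral>\<^sup>+t\<in>{0<..<\<delta>}. ennreal_powr (ennreal t / A t) p \<partial>lebesgue) = \<infinity>"
  shows "\<exists>N t. (\<forall>k. 0 \<le> t k) \<and> (\<Sum>k<N. ennreal (b ^ k) * A (t k)) \<le> 1 \<and> M \<le> (\<Sum>k<N. a ^ k * t k)"
proof -
  define \<mu> where "\<mu> = 1 / max M 1"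
  have \<mu>: "\<mu> > 0" "M \<le> 1 / \<mu>"
    by (auto simp: \<mu>_def)
  define r where "r = b / a"
  have r: "r > 1" "r powr p = a"
    using ab p by (auto simp: r_def)
  \<comment> \<open>The bound \<open>t < 1\<close> keeps the supremum finite even where
    \<open>A\<close> vanishes on a half-line or stays below the linear threshold.\<close>
  define E where "E k = {t. 0 < t \<and> t < 1 \<and> A t \<le> ennreal (\<mu> / r ^ k * t)}" for k :: nat
  define T where "T k = Sup (insert 0 (E k))" for k
  have bdd: "bdd_above (insert 0 (E k))" for k
    by (auto simp: E_def intro!: bdd_aboveI[of _ 1])
  have T_ge: "t \<le> T k" if "t \<in> E k" for t k
    unfolding T_def using that by (intro cSup_upper bdd) auto
  have T_nonneg: "0 \<le> T k" for k
    unfolding T_def by (intro cSup_upper bdd) auto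
  \<comment> \<open>The supremum need not belong to \<open>E k\<close>. Half of it, unless zero,
    lies strictly below some element \<open>e\<close> of \<open>E k\<close>, and since A(t)/t is
    nondecreasing the threshold inequality passes from \<open>e\<close> to \<tau>_k.\<close>
  define \<tau> where "\<tau> k = T k / 2" for k
  have \<tau>_nonneg: "0 \<le> \<tau> k" for k
    using T_nonneg by (simp add: \<tau>_def)
  have A_\<tau>: "A (\<tau> k) \<le> ennreal (\<mu> / r ^ k * \<tau> k)" for k
  proof (cases "T k = 0")
    case True
    then show ?thesis
      by (simp add: \<tau>_def young_function_0[OF A])
  next
    case False
    then have "\<tau> k < T k" "0 < \<tau> k"
      using T_nonneg[of k] by (auto simp: \<tau>_def)
    then obtain e where "e \<in> insert 0 (E k)" "\<tau> k < e"
      unfolding T_def using less_cSup_iff[OF _ bdd] by blast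
    with \<open>0 < \<tau> k\<close> have e: "\<tau> k < e" "0 < e" "A e \<le> ennreal (\<mu> / r ^ k * e)"
      by (auto simp: E_def)
    have "A (\<tau> k / e * e) \<le> ennreal (\<tau> k / e) * A e"
      using e \<open>0 < \<tau> k\<close> by (intro young_function_scale[OF A]) auto
    also have "\<dots> \<le> ennreal (\<tau> k / e) * ennreal (\<mu> / r ^ k * e)"
      by (intro mult_left_mono e) auto
    also have "\<dots> = ennreal (\<mu> / r ^ k * \<tau> k)"
      using e \<open>0 < \<tau> k\<close> \<mu> r by (subst ennreal_mult[symmetric]) (auto simp: field_simps)
    finally show ?thesis
      using e by simp
  qed
  define c where "c = \<mu> powr (- p)"
  have c: "c > 0"
    using \<mu> by (simp add: c_def)
  let ?S = "\<lambda>t. \<Sum>k. ennreal (a ^ Suc k) * indicator {0<..T k} t"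
  \<comment> \<open>For y = \<mu> t / A(t), the bound r^k \<le> y says exactly that \<open>t\<close>
    lies in \<open>E k\<close>, and y < r^(k+1) gives y^p \<le> a^(k+1) because r^p = a. The summand
    1 takes care of y \<le> 1, and \<mu>^(-p) undoes the rescaling. If A(t) = 0, then
    \<open>t\<close> lies in every \<open>E k\<close> and the sum is infinite as well.\<close>
  have pointwise: "ennreal_powr (ennreal t / A t) p \<le> ennreal c * (1 + ?S t)" if t: "t \<in> {0<..<1}" for t
  proof -
    have ge: "ennreal (a ^ Suc k) \<le> ?S t" if "t \<in> E k" for k
    proof -
      have "ennreal (a ^ Suc k) = (\<Sum>j\<in>{k}. ennreal (a ^ Suc j) * indicator {0<..T j} t)"
        using T_ge[OF that] t by simp
      also have "\<dots> \<le> ?S t"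
        by (rule sum_le_suminf) auto
      finally show ?thesis .
    qed
    consider "A t = 0" | "A t = \<infinity>" | \<alpha> where "A t = ennreal \<alpha>" "0 < \<alpha>"
      by (cases "A t") (auto simp: le_less)
    then show ?thesis
    proof cases
      case 1
      then have "t \<in> E k" for k
        using t by (simp add: E_def)
      then have "1 \<le> ennreal (a ^ Suc k) * indicator {0<..T k} t" for k
        using T_ge[of t k] t ab one_le_power[of a "Suc k"] by (simp del: power_Suc)
      then have "?S t = \<infinity>"
        by (rule suminf_ennreal_ge_1_eq_top)
      then show ?thesis
        using c by (simp add: ennreal_mult_top)
    next
      case 2
      then show ?thesis
        by (simp add: ennreal_powr_def)
    next
      case 3
      then have lhs: "ennreal_powr (ennreal t / A t) p = ennreal ((t / \<alpha>) powr p)"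
        using t by (simp add: divide_ennreal ennreal_powr_def)
      define y where "y = \<mu> * t / \<alpha>"
      have y: "y > 0" "t / \<alpha> = y / \<mu>"
        using t 3 \<mu> by (auto simp: y_def)
      have eq: "(t / \<alpha>) powr p = c * y powr p"
        unfolding y(2) using y(1) \<mu> by (simp add: powr_divide c_def powr_minus_divide)
      have "ennreal (y powr p) \<le> 1 + ?S t"
      proof (cases "y \<le> 1")
        case True
        then have "y powr p \<le> 1"
          using y p by (simp add: powr_le1)
        then show ?thesis
          by (metis add_increasing2 ennreal_le_1 zero_le)
      next
        case False
        then obtain k where k: "r ^ k \<le> y" "y < r ^ Suc k"
          using ex_power_interval[OF r(1), of y] by auto
        have "y powr p \<le> (r ^ Suc k) powr p"
          using k y p by (intro powr_mono2) auto
        also have "\<dots> = (r powr p) ^ Suc k"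
          using r by (simp only: powr_power[symmetric] powr_realpow[symmetric] powr_powr mult.commute)
             (metis powr_powr powr_realpow powr_gt_zero less_trans zero_less_one)
        finally have "y powr p \<le> a ^ Suc k"
          by (simp add: r)
        moreover have "t \<in> E k"
        proof -
          have "\<alpha> * r ^ k \<le> \<alpha> * y"
            using k 3 by simp
          then have "\<alpha> \<le> \<mu> / r ^ k * t"
            using 3 r t by (simp add: y_def field_simps)
          then show ?thesis
            using 3 t by (simp add: E_def ennreal_leI)
        qed
        ultimately show ?thesis
          using ge[of k] by (meson add_increasing dual_order.trans ennreal_leI zero_le)
      qed
      then have "ennreal c * ennreal (y powr p) \<le> ennreal c * (1 + ?S t)"
        by (intro mult_left_mono) auto
      then show ?thesis
        unfolding lhs eq using c by (simp add: ennreal_mult)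
    qed
  qed
  \<comment> \<open>Integrating the pointwise bound replaces each indicator by the length T_k = 2
    \<tau>_k, so summability would make the integral over (0,1) finite.\<close>
  have "\<not> summable (\<lambda>k. a ^ k * \<tau> k)"
  proof
    assume sum: "summable (\<lambda>k. a ^ k * \<tau> k)"
    have "(\<integral>\<^sup>+t\<in>{0<..<1}. ennreal_powr (ennreal t / A t) p \<partial>lebesgue) \<le>
        (\<integral>\<^sup>+t. ennreal c * (indicator {0<..<1} t + ?S t) \<partial>lebesgue)"
      using pointwise by (intro nn_integral_mono) (auto simp: indicator_def)
    also have "\<dots> = ennreal c * (1 + (\<Sum>k. ennreal (a ^ Suc k) * emeasure lebesgue {0<..T k}))"
      by (simp add: nn_integral_completion nn_integral_cmult nn_integral_add nn_integral_suminf)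
    also have "(\<Sum>k. ennreal (a ^ Suc k) * emeasure lebesgue {0<..T k}) = (\<Sum>k. ennreal (2 * a * (a ^ k * \<tau> k)))"
      using ab T_nonneg by (intro suminf_cong) (simp add: \<tau>_def ennreal_mult'[symmetric])
    also have "\<dots> = ennreal (\<Sum>k. 2 * a * (a ^ k * \<tau> k))"
      using ab \<tau>_nonneg by (intro suminf_ennreal2 summable_mult sum) auto
    also have "ennreal c * (1 + \<dots>) < \<infinity>"
      by (simp add: ennreal_mult_less_top)
    finally show False
      using div[of 1] by simp
  qed
  moreover have "summable (\<lambda>k. a ^ k * \<tau> k)" if "\<And>N. (\<Sum>k<N. a ^ k * \<tau> k) \<le> 1 / \<mu>"
    using that ab \<tau>_nonneg by (intro summableI_nonneg_bounded[where x = "1 / \<mu>"]) auto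
  ultimately obtain N where N: "1 / \<mu> < (\<Sum>k<N. a ^ k * \<tau> k)"
    by (meson not_le)
  define S where "S = (\<Sum>k<N. a ^ k * \<tau> k)"
  have S: "1 / \<mu> < S"
    using N by (simp add: S_def)
  moreover have "0 < 1 / \<mu>"
    using \<mu> by simp
  ultimately have S_pos: "0 < S"
    by linarith
  define \<kappa> where "\<kappa> = 1 / (\<mu> * S)"
  have \<kappa>: "0 < \<kappa>" "\<kappa> \<le> 1"
    using S S_pos \<mu> by (auto simp: \<kappa>_def field_simps)
  have "(\<Sum>k<N. ennreal (b ^ k) * A (\<kappa> * \<tau> k)) \<le> (\<Sum>k<N. ennreal (\<kappa> * \<mu> * (a ^ k * \<tau> k)))"
  proof (rule sum_mono)
    fix k
    have "A (\<kappa> * \<tau> k) \<le> ennreal \<kappa> * A (\<tau> k)"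
      using \<kappa> \<tau>_nonneg by (intro young_function_scale[OF A]) auto
    also have "\<dots> \<le> ennreal \<kappa> * ennreal (\<mu> / r ^ k * \<tau> k)"
      by (intro mult_left_mono A_\<tau>) auto
    finally have "ennreal (b ^ k) * A (\<kappa> * \<tau> k) \<le> ennreal (b ^ k) * (ennreal \<kappa> * ennreal (\<mu> / r ^ k * \<tau> k))"
      by (intro mult_left_mono) auto
    also have "\<dots> = ennreal (b ^ k * (\<kappa> * (\<mu> / r ^ k * \<tau> k)))"
      using \<kappa> \<mu> \<tau>_nonneg[of k] r ab by (simp add: ennreal_mult[symmetric])
    also have "b ^ k * (\<kappa> * (\<mu> / r ^ k * \<tau> k)) = \<kappa> * \<mu> * (a ^ k * \<tau> k)"
      using ab by (simp add: r_def power_divide)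
    finally show "ennreal (b ^ k) * A (\<kappa> * \<tau> k) \<le> ennreal (\<kappa> * \<mu> * (a ^ k * \<tau> k))" .
  qed
  also have "\<dots> = ennreal (\<kappa> * \<mu> * S)"
    unfolding S_def using \<kappa> \<mu> \<tau>_nonneg ab by (simp add: sum_distrib_left)
  also have "\<dots> = 1"
    using S_pos \<mu> by (simp add: \<kappa>_def)
  finally have "(\<Sum>k<N. ennreal (b ^ k) * A (\<kappa> * \<tau> k)) \<le> 1" .
  moreover have "(\<Sum>k<N. a ^ k * (\<kappa> * \<tau> k)) = \<kappa> * S"
    by (simp add: S_def sum_distrib_left mult_ac)
  then have "M \<le> (\<Sum>k<N. a ^ k * (\<kappa> * \<tau> k))"
    using S_pos \<mu> by (simp add: \<kappa>_def)
  moreover have "\<forall>k. 0 \<le> \<kappa> * \<tau> k"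
    using \<kappa> \<tau>_nonneg by simp
  ultimately show ?thesis
    by (intro exI[of _ N] exI[of _ "\<lambda>k. \<kappa> * \<tau> k"] conjI)
qed

section \<open>The Gagliardo kernel at dyadic scales\<close>

definition scale_kernel :: "real \<Rightarrow> real \<Rightarrow> real" where
  "scale_kernel \<sigma> r = min 1 r / r powr \<sigma>"

lemma scale_kernel_nonneg: "0 \<le> r \<Longrightarrow> 0 \<le> scale_kernel \<sigma> r"
  by (simp add: scale_kernel_def)

lemma scale_kernel_le_near:
  assumes "0 < r" "r \<le> (1 / 2) ^ j" "\<sigma> < 1"
  shows "scale_kernel \<sigma> r \<le> (2 powr (\<sigma> - 1)) ^ j"
proof -
  have "scale_kernel \<sigma> r \<le> r / r powr \<sigma>"
    using assms by (simp add: scale_kernel_def divide_right_mono)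
  also have "\<dots> = r powr (1 - \<sigma>)"
    using assms by (simp add: powr_diff)
  also have "\<dots> \<le> ((1 / 2) ^ j) powr (1 - \<sigma>)"
    using assms by (intro powr_mono2) auto
  also have "\<dots> = (2 powr (\<sigma> - 1)) ^ j"
    by (simp add: powr_realpow[symmetric] powr_powr powr_divide powr_minus_divide[symmetric] algebra_simps)
  finally show ?thesis .
qed

lemma scale_kernel_le_far:
  assumes "2 ^ j \<le> r" "0 < \<sigma>"
  shows "scale_kernel \<sigma> r \<le> (2 powr (- \<sigma>)) ^ j"
proof -
  have r: "0 < r"
    using assms(1) by (rule less_le_trans[rotated]) simp
  have "scale_kernel \<sigma> r \<le> 1 / r powr \<sigma>"
    using r by (simp add: scale_kernel_def divide_right_mono)
  also have "\<dots> \<le> 1 / (2 ^ j) powr \<sigma>"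
    using assms r by (intro divide_left_mono powr_mono2) auto
  also have "\<dots> = (2 powr (- \<sigma>)) ^ j"
    by (simp add: powr_realpow[symmetric] powr_powr powr_minus_divide[symmetric] mult.commute)
  finally show ?thesis .
qed

lemma sum_inj_power_le:
  fixes x :: real
  assumes "finite I" "inj_on e I" "0 \<le> x" "x < 1"
  shows "(\<Sum>i\<in>I. x ^ e i) \<le> 1 / (1 - x)"
proof -
  have "(\<Sum>i\<in>I. x ^ e i) = (\<Sum>j\<in>e ` I. x ^ j)"
    using assms by (simp add: sum.reindex)
  also have "\<dots> \<le> (\<Sum>j. x ^ j)"
    using assms by (intro sum_le_suminf summable_geometric) auto
  also have "\<dots> = 1 / (1 - x)"
    using assms by (intro suminf_geometric) auto
  finally show ?thesis .
qed

lemma two_powr_neg_less_1: "x < 0 \<Longrightarrow> 2 powr x < (1::real)"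
  using powr_less_mono[of x 0 2] by simp

lemma sum_scale_kernel_bounded:
  assumes \<sigma>: "0 < \<sigma>" "\<sigma> < 1"
  obtains C where "\<And>d N. 0 < d \<Longrightarrow> (\<Sum>k<N. scale_kernel \<sigma> (d / 2 ^ k)) \<le> C"
proof
  let ?p = "2 powr (- \<sigma>)" and ?q = "2 powr (\<sigma> - 1)"
  fix d :: real and N :: nat
  assume d: "0 < d"
  \<comment> \<open>\<open>j\<close> is the dyadic scale of \<open>d\<close>: scales up to
    \<open>j\<close> see the points as far apart, later ones as close. Using \<open>max 1 d\<close>
    merges all \<open>d < 1\<close> into \<open>j = 0\<close>; there only \<open>k = 0\<close> falls
    in the first branch, and its kernel is at most 1.\<close>
  obtain j where j: "2 ^ j \<le> max 1 d" "max 1 d < 2 ^ Suc j"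
    using ex_power_interval[of 2 "max 1 d"] by auto
  have "scale_kernel \<sigma> (d / 2 ^ k) \<le> (if k \<le> j then ?p ^ (j - k) else ?q ^ (k - Suc j))" for k
  proof (cases "k \<le> j")
    case True
    show ?thesis
    proof (cases "1 \<le> d")
      case d1: True
      have "(2::real) ^ j = 2 ^ (j - k) * 2 ^ k"
        using True by (simp flip: power_add)
      then have "2 ^ (j - k) \<le> d / 2 ^ k"
        using j d1 by (simp add: field_simps)
      then show ?thesis
        using scale_kernel_le_far[OF _ \<sigma>(1)] True by simp
    next
      case False
      then have "(2::real) ^ j \<le> 1"
        using j by simp
      then have "j = 0"
        by (metis not_gr_zero not_le one_less_numeral_iff one_less_power semiring_norm(76))
      then show ?thesis
        using scale_kernel_le_near[of d 0 \<sigma>] False True d \<sigma> by simp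
    qed
  next
    case False
    then have "(2::real) ^ k = 2 ^ (k - Suc j) * 2 ^ Suc j"
      by (simp flip: power_add power_Suc)
    then have "d / 2 ^ k \<le> (1 / 2) ^ (k - Suc j)"
      using j by (simp add: field_simps)
    then show ?thesis
      using scale_kernel_le_near[OF _ _ \<sigma>(2)] False d by simp
  qed
  then have "(\<Sum>k<N. scale_kernel \<sigma> (d / 2 ^ k)) \<le>
      (\<Sum>k<N. if k \<le> j then ?p ^ (j - k) else ?q ^ (k - Suc j))"
    by (rule sum_mono)
  also have "\<dots> = (\<Sum>k\<in>{..<N} \<inter> {k. k \<le> j}. ?p ^ (j - k)) + (\<Sum>k\<in>{..<N} \<inter> - {k. k \<le> j}. ?q ^ (k - Suc j))"
    by (rule sum.If_cases) simp
  also have "\<dots> \<le> 1 / (1 - ?p) + 1 / (1 - ?q)"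
    using \<sigma> by (intro add_mono sum_inj_power_le two_powr_neg_less_1) (auto simp: inj_on_def)
  finally show "(\<Sum>k<N. scale_kernel \<sigma> (d / 2 ^ k)) \<le> 1 / (1 - ?p) + 1 / (1 - ?q)" .
qed

lemma measurable_scale_kernel [measurable]: "scale_kernel \<sigma> \<in> borel_measurable borel"
  unfolding scale_kernel_def by measurable

lemma nn_integral_suminf_indicator:
  fixes B :: "nat \<Rightarrow> 'a set"
  assumes [measurable]: "\<And>j. B j \<in> sets M"
  shows "(\<lambda>x. \<Sum>j. c j * indicator (B j) x) \<in> borel_measurable M"
    and "(\<integral>\<^sup>+x. (\<Sum>j. c j * indicator (B j) x) \<partial>M) = (\<Sum>j. c j * emeasure M (B j))"
  by (auto simp: nn_integral_suminf nn_integral_cmult)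

text \<open>The measure |h|^-n dh is dilation invariant, so the bound cannot depend on
  \<open>R\<close>. Each dyadic shell has bounded mass for it, and the kernel decays geometrically
  towards 0 and towards infinity. Shells are enlarged to balls, so that only ball volumes are needed
  instead of polar coordinates.\<close>

lemma nn_integral_scale_kernel_bounded:
  assumes \<sigma>: "0 < \<sigma>" "\<sigma> < 1"
  obtains C where "0 \<le> C"
    "\<And>R. 0 < R \<Longrightarrow> (\<integral>\<^sup>+h. ennreal (scale_kernel \<sigma> (norm (h :: real ^ 'n::finite) / R) / norm h ^ CARD('n)) \<partial>lborel) \<le> ennreal C"
proof
  let ?p = "2 powr (- \<sigma>)" and ?q = "2 powr (\<sigma> - 1)"
  have pq: "0 \<le> ?p" "?p < 1" "0 \<le> ?q" "?q < 1"
    using \<sigma> by (auto simp: two_powr_neg_less_1)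
  let ?n = "CARD('n)"
  define v where "v = unit_ball_vol (real ?n)"
  have v: "0 \<le> v"
    by (simp add: v_def)
  let ?C = "v * 2 ^ ?n / (1 - ?q) + v * 2 ^ ?n / (1 - ?p)"
  show "0 \<le> ?C"
    using pq v by simp
  fix R :: real
  assume R: "0 < R"
  \<comment> \<open>Upper bounds for kernel times |h|^-n on the shells R/2^(j+1) < |h| \<le> R/2^j
    for \<open>c\<close> and 2^j R \<le> |h| < 2^(j+1) R for \<open>d\<close>. Multiplied by the
    volume of the enclosing ball, both leave \<open>v * 2 ^ ?n\<close> times a geometric term, with
    \<open>R\<close> cancelled.\<close>
  define c where "c j = ?q ^ j * ((2 ^ Suc j) / R) ^ ?n" for j
  define d where "d j = ?p ^ j / (2 ^ j * R) ^ ?n" for j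
  let ?c = "\<lambda>h::real ^ 'n. \<Sum>j. ennreal (c j) * indicator (cball 0 (R / 2 ^ j)) h"
  let ?d = "\<lambda>h::real ^ 'n. \<Sum>j. ennreal (d j) * indicator (cball 0 (R * 2 ^ Suc j)) h"
  have "ennreal (scale_kernel \<sigma> (norm h / R) / norm h ^ ?n) \<le> ?c h + ?d h" for h
  proof -
    have c_le: "ennreal (c j) \<le> ?c h" if "norm h \<le> R / 2 ^ j" for j
    proof -
      have "ennreal (c j) = (\<Sum>j\<in>{j}. ennreal (c j) * indicator (cball 0 (R / 2 ^ j)) h)"
        using that by simp
      also have "\<dots> \<le> ?c h"
        by (rule sum_le_suminf) auto
      finally show ?thesis .
    qed
    have d_le: "ennreal (d j) \<le> ?d h" if "norm h \<le> R * 2 ^ Suc j" for j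
    proof -
      have "ennreal (d j) = (\<Sum>j\<in>{j}. ennreal (d j) * indicator (cball 0 (R * 2 ^ Suc j)) h)"
        using that by simp
      also have "\<dots> \<le> ?d h"
        by (rule sum_le_suminf) auto
      finally show ?thesis .
    qed
    define r where "r = norm h / R"
    have h: "norm h = r * R"
      using R by (simp add: r_def)
    have "0 \<le> r"
      using R by (simp add: r_def)
    then consider "r = 0" | "0 < r" "r \<le> 1" | "1 \<le> r"
      by linarith
    then show ?thesis
    proof cases
      case 1
      then show ?thesis
        unfolding h by (simp add: scale_kernel_def)
    next
      case 2
      then obtain j where j: "2 ^ j \<le> 1 / r" "1 / r < 2 ^ Suc j"
        using ex_power_interval[of 2 "1 / r"] by auto
      have "norm h \<le> R / 2 ^ j"
        using j 2 R unfolding h by (simp add: field_simps)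
      note le = c_le[OF this]
      have "scale_kernel \<sigma> r / (r * R) ^ ?n = scale_kernel \<sigma> r * ((1 / r) / R) ^ ?n"
        by (simp add: power_divide power_mult_distrib)
      also have "\<dots> \<le> c j"
        unfolding c_def
      proof (rule mult_mono)
        show "scale_kernel \<sigma> r \<le> ?q ^ j"
          using j 2 by (intro scale_kernel_le_near \<sigma>) (auto simp: field_simps power_divide)
        show "(1 / r / R) ^ ?n \<le> (2 ^ Suc j / R) ^ ?n"
          using j 2 R by (intro power_mono divide_right_mono) auto
      qed (use 2 R in auto)
      finally have "ennreal (scale_kernel \<sigma> (norm h / R) / norm h ^ ?n) \<le> ennreal (c j)"
        using R by (intro ennreal_leI) (simp add: h)
      then show ?thesis
        using le by (meson add_increasing2 dual_order.trans zero_le)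
    next
      case 3
      then obtain j where j: "2 ^ j \<le> r" "r < 2 ^ Suc j"
        using ex_power_interval[of 2 r] by auto
      have "norm h \<le> R * 2 ^ Suc j"
        using j R unfolding h by (simp add: mult.commute)
      note le = d_le[OF this]
      have "scale_kernel \<sigma> r / (r * R) ^ ?n \<le> d j"
        unfolding d_def
      proof (rule frac_le)
        show "scale_kernel \<sigma> r \<le> ?p ^ j"
          using j by (intro scale_kernel_le_far \<sigma>)
        show "(2 ^ j * R) ^ ?n \<le> (r * R) ^ ?n"
          using j R by (intro power_mono mult_right_mono) auto
      qed (use R in auto)
      then have "ennreal (scale_kernel \<sigma> (norm h / R) / norm h ^ ?n) \<le> ennreal (d j)"
        using R by (intro ennreal_leI) (simp add: h)
      then show ?thesis
        using le by (meson add_increasing dual_order.trans zero_le)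
    qed
  qed
  then have "(\<integral>\<^sup>+h. ennreal (scale_kernel \<sigma> (norm (h :: real ^ 'n) / R) / norm h ^ ?n) \<partial>lborel) \<le>
      (\<integral>\<^sup>+h. ?c h + ?d h \<partial>lborel)"
    by (rule nn_integral_mono)
  also have "\<dots> = (\<Sum>j. ennreal (c j) * emeasure lborel (cball (0 :: real ^ 'n) (R / 2 ^ j))) +
      (\<Sum>j. ennreal (d j) * emeasure lborel (cball (0 :: real ^ 'n) (R * 2 ^ Suc j)))"
    by (subst nn_integral_add) (auto simp: nn_integral_suminf_indicator)
  also have "(\<Sum>j. ennreal (c j) * emeasure lborel (cball (0 :: real ^ 'n) (R / 2 ^ j))) =
      (\<Sum>j. ennreal (v * 2 ^ ?n * ?q ^ j))"
  proof (rule suminf_cong)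
    fix j
    have "c j * (v * (R / 2 ^ j) ^ ?n) = v * 2 ^ ?n * ?q ^ j"
      using R by (simp add: c_def power_divide power_mult_distrib)
    then show "ennreal (c j) * emeasure lborel (cball (0 :: real ^ 'n) (R / 2 ^ j)) =
        ennreal (v * 2 ^ ?n * ?q ^ j)"
      using R v pq by (subst emeasure_cball) (auto simp: v_def ennreal_mult[symmetric] c_def)
  qed
  also have "(\<Sum>j. ennreal (d j) * emeasure lborel (cball (0 :: real ^ 'n) (R * 2 ^ Suc j))) =
      (\<Sum>j. ennreal (v * 2 ^ ?n * ?p ^ j))"
  proof (rule suminf_cong)
    fix j
    have "d j * (v * (R * 2 ^ Suc j) ^ ?n) = v * 2 ^ ?n * ?p ^ j"
      using R by (simp add: d_def power_mult_distrib)
    then show "ennreal (d j) * emeasure lborel (cball (0 :: real ^ 'n) (R * 2 ^ Suc j)) =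
        ennreal (v * 2 ^ ?n * ?p ^ j)"
      using R v pq by (subst emeasure_cball) (auto simp: v_def ennreal_mult[symmetric] d_def)
  qed
  also have "(\<Sum>j. ennreal (v * 2 ^ ?n * ?q ^ j)) = ennreal (v * 2 ^ ?n / (1 - ?q))"
    using pq v by (subst suminf_ennreal2) (auto simp: suminf_mult suminf_geometric summable_geometric intro!: summable_mult)
  also have "(\<Sum>j. ennreal (v * 2 ^ ?n * ?p ^ j)) = ennreal (v * 2 ^ ?n / (1 - ?p))"
    using pq v by (subst suminf_ennreal2) (auto simp: suminf_mult suminf_geometric summable_geometric intro!: summable_mult)
  also have "ennreal (v * 2 ^ ?n / (1 - ?q)) + ennreal (v * 2 ^ ?n / (1 - ?p)) = ennreal ?C"
    using pq v by (intro ennreal_plus[symmetric]) auto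
  finally show "(\<integral>\<^sup>+h. ennreal (scale_kernel \<sigma> (norm (h :: real ^ 'n) / R) / norm h ^ ?n) \<partial>lborel) \<le> ennreal ?C" .
qed

section \<open>The modular estimate\<close>

lemma nn_integral_lborel_translate:
  fixes f :: "'a::euclidean_space \<Rightarrow> ennreal"
  assumes [measurable]: "f \<in> borel_measurable borel"
  shows "(\<integral>\<^sup>+y. f (y - x) \<partial>lborel) = (\<integral>\<^sup>+h. f h \<partial>lborel)"
proof -
  have "(\<integral>\<^sup>+h. f h \<partial>lborel) = (\<integral>\<^sup>+h. f h \<partial>distr lborel borel ((+) (- x)))"
    by (simp only: lborel_distr_plus)
  also have "\<dots> = (\<integral>\<^sup>+y. f (- x + y) \<partial>lborel)"
    by (rule nn_integral_distr) auto
  finally show ?thesis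
    by simp
qed

text \<open>The sum of indicators localises a pair of points of which at least one lies in
  \<open>K\<close>. Integrating first over the other variable, after Tonelli in one of the two
  halves, translation invariance makes each half the measure of \<open>K\<close> times the integral
  of \<open>f\<close>; evenness serves the half whose inner variable is \<open>y\<close>.\<close>

lemma nn_integral_difference_kernel:
  fixes f :: "'a::euclidean_space \<Rightarrow> ennreal"
  assumes f [measurable]: "f \<in> borel_measurable borel" and K [measurable]: "K \<in> sets borel"
    and sym: "\<And>h. f (- h) = f h"
  shows "(\<integral>\<^sup>+x. \<integral>\<^sup>+y. f (x - y) * (indicator K x + indicator K y) \<partial>lborel \<partial>lborel) =
    2 * emeasure lborel K * (\<integral>\<^sup>+h. f h \<partial>lborel)"
proof -
  let ?J = "\<integral>\<^sup>+h. f h \<partial>lborel"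
  have x: "(\<integral>\<^sup>+y. f (x - y) \<partial>lborel) = ?J" for x
    using nn_integral_lborel_translate[OF f, of x] sym by (metis (no_types, lifting) minus_diff_eq nn_integral_cong)
  have y: "(\<integral>\<^sup>+x. f (x - y) \<partial>lborel) = ?J" for y
    by (rule nn_integral_lborel_translate[OF f])
  have "(\<integral>\<^sup>+x. \<integral>\<^sup>+y. f (x - y) * (indicator K x + indicator K y) \<partial>lborel \<partial>lborel) =
      (\<integral>\<^sup>+x. (\<integral>\<^sup>+y. f (x - y) * indicator K x \<partial>lborel) + (\<integral>\<^sup>+y. f (x - y) * indicator K y \<partial>lborel) \<partial>lborel)"
    by (intro nn_integral_cong) (simp add: distrib_left nn_integral_add)
  also have "\<dots> = (\<integral>\<^sup>+x. (\<integral>\<^sup>+y. f (x - y) * indicator K x \<partial>lborel) \<partial>lborel) +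
      (\<integral>\<^sup>+x. (\<integral>\<^sup>+y. f (x - y) * indicator K y \<partial>lborel) \<partial>lborel)"
    by (rule nn_integral_add) measurable
  also have "(\<integral>\<^sup>+x. (\<integral>\<^sup>+y. f (x - y) * indicator K y \<partial>lborel) \<partial>lborel) =
      (\<integral>\<^sup>+y. (\<integral>\<^sup>+x. f (x - y) * indicator K y \<partial>lborel) \<partial>lborel)"
    by (rule lborel_pair.Fubini') measurable
  finally have "(\<integral>\<^sup>+x. \<integral>\<^sup>+y. f (x - y) * (indicator K x + indicator K y) \<partial>lborel \<partial>lborel) =
      ?J * emeasure lborel K + ?J * emeasure lborel K"
    by (simp add: nn_integral_multc nn_integral_cmult x y)
  also have "\<dots> = 2 * emeasure lborel K * ?J"
    by (simp add: mult_2 distrib_left mult.commute)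
  finally show ?thesis .
qed

text \<open>The two conditions on \<open>D\<close> have separate tasks: \<open>D1\<close> makes the
  Jensen weights sum to at most 1 at every pair of points, the 2 coming from the two indicators, and
  \<open>D2\<close> absorbs all constants after integration, so that the coefficient of A(t_k) is at
  most 2^(kn).\<close>

lemma frac_modular_le:
  fixes v :: "real ^ 'n::finite \<Rightarrow> 'i \<Rightarrow> real"
  assumes A: "young_function A" and t: "\<And>k. 0 \<le> t k" and C: "0 \<le> C" and \<rho>: "0 \<le> \<rho>" and D: "0 < D"
    and est: "\<And>x y. x \<noteq> y \<Longrightarrow> L2_set (\<lambda>i. v x i - v y i) I / norm (x - y) powr \<sigma> \<le>
      (\<Sum>k<N. t k * (C * scale_kernel \<sigma> (norm (x - y) / 2 ^ k) *
        (indicator (cball 0 (2 ^ k * \<rho>)) x + indicator (cball 0 (2 ^ k * \<rho>)) y)))"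
    and sum_le: "\<And>d. 0 < d \<Longrightarrow> (\<Sum>k<N. scale_kernel \<sigma> (d / 2 ^ k)) \<le> C1"
    and int_le: "\<And>R. 0 < R \<Longrightarrow> (\<integral>\<^sup>+h. ennreal (scale_kernel \<sigma> (norm (h :: real ^ 'n) / R) / norm h ^ CARD('n)) \<partial>lborel) \<le> ennreal C2"
    and C2: "0 \<le> C2"
    and D1: "2 * C * C1 \<le> D"
    and D2: "2 * C * C2 * (unit_ball_vol (real CARD('n)) * \<rho> ^ CARD('n)) \<le> D"
  shows "frac_modular \<sigma> A I (\<lambda>x i. v x i / D) \<le> (\<Sum>k<N. ennreal ((2 ^ CARD('n)) ^ k) * A (t k))"
proof -
  let ?n = "CARD('n)"
  let ?K = "\<lambda>k. cball (0 :: real ^ 'n) (2 ^ k * \<rho>)"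
  define f :: "nat \<Rightarrow> real ^ 'n \<Rightarrow> ennreal"
    where "f k h = ennreal (scale_kernel \<sigma> (norm h / 2 ^ k) / norm h ^ ?n)" for k h
  have [measurable]: "f k \<in> borel_measurable borel" for k
    unfolding f_def by measurable
  have pointwise: "A (L2_set (\<lambda>i. v x i / D - v y i / D) I / norm (x - y) powr \<sigma>) / ennreal (norm (x - y) ^ ?n) \<le>
      (\<Sum>k<N. A (t k) * ennreal (C / D) * (f k (x - y) * (indicator (?K k) x + indicator (?K k) y)))"
    for x y
  proof (cases "x = y")
    case True
    then show ?thesis
      by (simp add: young_function_0[OF A])
  next
    case False
    define d where "d = norm (x - y)"
    have d: "0 < d"
      using False by (simp add: d_def)
    define \<theta> where "\<theta> k = (indicator (?K k) x + indicator (?K k) y :: real)" for k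
    have \<theta>: "0 \<le> \<theta> k" "\<theta> k \<le> 2" for k
      by (auto simp: \<theta>_def indicator_def)
    have ker: "0 \<le> scale_kernel \<sigma> (d / 2 ^ k)" for k
      using d by (intro scale_kernel_nonneg) auto
    \<comment> \<open>The Jensen weights depend on the pair \<open>x\<close>, \<open>y\<close>; the
      numbers t_k stay outside them as the points at which \<open>A\<close> is evaluated.\<close>
    define w where "w k = C / D * scale_kernel \<sigma> (d / 2 ^ k) * \<theta> k" for k
    have w: "0 \<le> w k" for k
      using C D ker \<theta> by (simp add: w_def)
    have "(\<Sum>k<N. w k) \<le> (\<Sum>k<N. C / D * scale_kernel \<sigma> (d / 2 ^ k) * 2)"
      unfolding w_def using C D ker \<theta> by (intro sum_mono mult_left_mono) auto
    also have "\<dots> = 2 * C / D * (\<Sum>k<N. scale_kernel \<sigma> (d / 2 ^ k))"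
      by (simp add: sum_distrib_left mult_ac)
    also have "\<dots> \<le> 2 * C / D * C1"
      using C D d by (intro mult_left_mono sum_le) auto
    also have "\<dots> \<le> 1"
      using D D1 by (simp add: field_simps)
    finally have w_sum: "(\<Sum>k<N. w k) \<le> 1" .
    have "L2_set (\<lambda>i. v x i / D - v y i / D) I = L2_set (\<lambda>i. (v x i - v y i)) I / D"
      using D L2_set_right_distrib[of "1 / D" "\<lambda>i. v x i - v y i" I] by (simp add: diff_divide_distrib)
    then have "L2_set (\<lambda>i. v x i / D - v y i / D) I / d powr \<sigma> =
        (L2_set (\<lambda>i. (v x i - v y i)) I / d powr \<sigma>) / D"
      by simp
    also have "\<dots> \<le> (\<Sum>k<N. t k * (C * scale_kernel \<sigma> (d / 2 ^ k) * \<theta> k)) / D"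
      using est[OF False] D unfolding d_def \<theta>_def by (intro divide_right_mono) auto
    also have "\<dots> = (\<Sum>k<N. w k * t k)"
      by (simp add: sum_divide_distrib w_def mult_ac)
    finally have "A (L2_set (\<lambda>i. v x i / D - v y i / D) I / d powr \<sigma>) \<le> A (\<Sum>k<N. w k * t k)"
      by (intro young_function_mono[OF A]) auto
    also have "\<dots> \<le> (\<Sum>k<N. ennreal (w k) * A (t k))"
      using w t w_sum by (intro young_function_jensen[OF A]) auto
    finally have "A (L2_set (\<lambda>i. v x i / D - v y i / D) I / d powr \<sigma>) / ennreal (d ^ ?n) \<le>
        (\<Sum>k<N. ennreal (w k) * A (t k)) / ennreal (d ^ ?n)"
      by (rule divide_right_mono_ennreal)
    also have "\<dots> = (\<Sum>k<N. A (t k) * (ennreal (w k) / ennreal (d ^ ?n)))"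
      by (simp add: divide_ennreal_def sum_distrib_left mult_ac)
    also have "\<dots> = (\<Sum>k<N. A (t k) * ennreal (C / D) * (f k (x - y) * (indicator (?K k) x + indicator (?K k) y)))"
    proof (rule sum.cong[OF refl])
      fix k
      have "ennreal (w k) / ennreal (d ^ ?n) = ennreal (w k / d ^ ?n)"
        using w d by (intro divide_ennreal) auto
      also have "w k / d ^ ?n = C / D * (scale_kernel \<sigma> (d / 2 ^ k) / d ^ ?n * \<theta> k)"
        by (simp add: w_def)
      also have "ennreal \<dots> = ennreal (C / D) * (f k (x - y) * ennreal (\<theta> k))"
      proof -
        have nonneg: "0 \<le> C / D" "0 \<le> scale_kernel \<sigma> (d / 2 ^ k) / d ^ ?n"
          using C D ker[of k] d by auto
        show ?thesis
          unfolding f_def d_def[symmetric]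
          by (simp only: ennreal_mult nonneg \<theta> mult_nonneg_nonneg)
      qed
      also have "ennreal (\<theta> k) = indicator (?K k) x + indicator (?K k) y"
        unfolding \<theta>_def by (simp add: ennreal_indicator ennreal_plus)
      finally show "A (t k) * (ennreal (w k) / ennreal (d ^ ?n)) =
          A (t k) * ennreal (C / D) * (f k (x - y) * (indicator (?K k) x + indicator (?K k) y))"
        by (simp add: mult.assoc)
    qed
    finally show ?thesis
      unfolding d_def .
  qed
  \<comment> \<open>The majorant is Borel, and monotonicity compares it with an integrand of unknown
    measurability; from here on only the majorant is integrated.\<close>
  have "frac_modular \<sigma> A I (\<lambda>x i. v x i / D) \<le>
      (\<integral>\<^sup>+x. \<integral>\<^sup>+y. (\<Sum>k<N. A (t k) * ennreal (C / D) * (f k (x - y) * (indicator (?K k) x + indicator (?K k) y))) \<partial>lborel \<partial>lborel)"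
    unfolding frac_modular_def nn_integral_completion by (intro nn_integral_mono pointwise)
  also have "\<dots> = (\<Sum>k<N. A (t k) * ennreal (C / D) *
      (\<integral>\<^sup>+x. \<integral>\<^sup>+y. f k (x - y) * (indicator (?K k) x + indicator (?K k) y) \<partial>lborel \<partial>lborel))"
  proof -
    have [measurable]: "cball (0 :: real ^ 'n) r \<in> sets borel" for r
      by simp
    have m1: "(\<lambda>y. f k (x - y) * (indicator (?K k) x + indicator (?K k) y)) \<in> borel_measurable lborel" for k x
      by measurable
    have m2: "(\<lambda>x. \<integral>\<^sup>+y. f k (x - y) * (indicator (?K k) x + indicator (?K k) y) \<partial>lborel) \<in> borel_measurable lborel" for k
      by measurable
    show ?thesis
      by (simp add: nn_integral_sum nn_integral_cmult m1 m2)
  qed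
  also have "\<dots> \<le> (\<Sum>k<N. ennreal ((2 ^ ?n) ^ k) * A (t k))"
  proof (rule sum_mono)
    fix k
    let ?V = "unit_ball_vol (real ?n) * \<rho> ^ ?n"
    have V: "0 \<le> ?V"
      using \<rho> by simp
    have "(\<integral>\<^sup>+x. \<integral>\<^sup>+y. f k (x - y) * (indicator (?K k) x + indicator (?K k) y) \<partial>lborel \<partial>lborel) =
        2 * emeasure lborel (?K k) * (\<integral>\<^sup>+h. f k h \<partial>lborel)"
      by (intro nn_integral_difference_kernel) (auto simp: f_def)
    also have "\<dots> \<le> 2 * emeasure lborel (?K k) * ennreal C2"
      using int_le[of "2 ^ k"] unfolding f_def by (intro mult_left_mono) auto
    also have "emeasure lborel (?K k) = ennreal (?V * (2 ^ ?n) ^ k)"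
    proof -
      have "((2::real) ^ k) ^ ?n = (2 ^ ?n) ^ k"
        by (metis mult.commute power_mult)
      then have "unit_ball_vol (real ?n) * (2 ^ k * \<rho>) ^ ?n = ?V * (2 ^ ?n) ^ k"
        by (simp add: power_mult_distrib)
      then show ?thesis
        using \<rho> by (subst emeasure_cball) auto
    qed
    also have "2 * ennreal (?V * (2 ^ ?n) ^ k) * ennreal C2 = ennreal (2 * (?V * (2 ^ ?n) ^ k) * C2)"
      using V C2 by (simp add: ennreal_mult' ennreal_mult'')
    finally have "ennreal (C / D) * (\<integral>\<^sup>+x. \<integral>\<^sup>+y. f k (x - y) * (indicator (?K k) x + indicator (?K k) y) \<partial>lborel \<partial>lborel)
        \<le> ennreal (C / D) * ennreal (2 * (?V * (2 ^ ?n) ^ k) * C2)"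
      by (intro mult_left_mono) auto
    also have "\<dots> = ennreal (C / D * (2 * (?V * (2 ^ ?n) ^ k) * C2))"
      using C D by (intro ennreal_mult'[symmetric]) auto
    also have "\<dots> \<le> ennreal ((2 ^ ?n) ^ k)"
    proof (rule ennreal_leI)
      have "C / D * (2 * (?V * (2 ^ ?n) ^ k) * C2) = (2 * C * C2 * ?V) / D * (2 ^ ?n) ^ k"
        by simp
      also have "\<dots> \<le> 1 * (2 ^ ?n) ^ k"
        using D2 D by (intro mult_right_mono) auto
      finally show "C / D * (2 * (?V * (2 ^ ?n) ^ k) * C2) \<le> (2 ^ ?n) ^ k"
        by simp
    qed
    finally show "A (t k) * ennreal (C / D) *
        (\<integral>\<^sup>+x. \<integral>\<^sup>+y. f k (x - y) * (indicator (?K k) x + indicator (?K k) y) \<partial>lborel \<partial>lborel) \<le>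
        ennreal ((2 ^ ?n) ^ k) * A (t k)"
      by (subst mult.commute[of "ennreal ((2 ^ ?n) ^ k)"]) (auto simp: mult.assoc intro: mult_left_mono)
  qed
  finally show ?thesis .
qed

lemma test_function_difference_bound:
  fixes g :: "real ^ 'n::finite \<Rightarrow> real"
  assumes "test_function g"
  obtains C where "0 \<le> C" "\<And>x y. \<bar>g x - g y\<bar> \<le> C * min 1 (norm (x - y))"
proof -
  have g: "smooth g" "bounded {x. g x \<noteq> 0}"
    using assms by (auto simp: test_function_iff)
  obtain M0 where M0: "M0 > 0" "\<And>x. \<bar>g x\<bar> \<le> M0"
    using continuous_bounded_support_bounded[OF smooth_continuous[OF g(1)] g(2)] by blast
  have "\<exists>M. \<forall>x. \<bar>partial_deriv i g x\<bar> \<le> M" for i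
  proof -
    have "smooth (partial_deriv i g)" "bounded {x. partial_deriv i g x \<noteq> 0}"
      using test_function_partial_deriv[OF assms] by (auto simp: test_function_iff)
    from continuous_bounded_support_bounded[OF smooth_continuous[OF this(1)] this(2)]
    show ?thesis
      by blast
  qed
  then obtain M where M: "\<And>i x. \<bar>partial_deriv i g x\<bar> \<le> M i"
    by metis
  define B where "B = (\<Sum>i\<in>UNIV. M i)"
  have M_nonneg: "0 \<le> M i" for i
    using M[of i 0] by linarith
  have B: "0 \<le> B"
    unfolding B_def by (intro sum_nonneg M_nonneg)
  have lip: "\<bar>g x - g y\<bar> \<le> B * norm (x - y)" for x y
  proof -
    have "norm (g x - g y) \<le> B * norm (x - y)"
    proof (rule differentiable_bound[where S = UNIV and f' = "\<lambda>x. frechet_derivative g (at x)"])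
      fix x :: "real ^ 'n"
      have der: "(g has_derivative frechet_derivative g (at x)) (at x)"
        by (rule differentiable_on_UNIV_D[OF smooth_differentiable[OF g(1)]])
      then show "(g has_derivative frechet_derivative g (at x)) (at x within UNIV)"
        by simp
      have lin: "linear (frechet_derivative g (at x))"
        using der by (rule has_derivative_linear)
      show "onorm (frechet_derivative g (at x)) \<le> B"
      proof (rule onorm_bound[OF B])
        fix h :: "real ^ 'n"
        have "frechet_derivative g (at x) h = frechet_derivative g (at x) (\<Sum>i\<in>UNIV. h $ i *\<^sub>R axis i 1)"
          using basis_expansion[of h] by (simp add: scalar_mult_eq_scaleR)
        also have "\<dots> = (\<Sum>i\<in>UNIV. h $ i * partial_deriv i g x)"
          using lin by (simp add: linear_sum linear_scale partial_deriv_def)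
        also have "norm \<dots> \<le> (\<Sum>i\<in>UNIV. norm h * M i)"
        proof (rule sum_norm_le)
          fix i
          show "norm (h $ i * partial_deriv i g x) \<le> norm h * M i"
            using component_le_norm_cart[of h i] M[of i x] by (simp add: abs_mult mult_mono)
        qed
        also have "\<dots> = B * norm h"
          by (simp add: B_def sum_distrib_left mult.commute)
        finally show "norm (frechet_derivative g (at x) h) \<le> B * norm h" .
      qed
    qed auto
    then show ?thesis
      by simp
  qed
  show ?thesis
  proof
    show "0 \<le> max B (2 * M0)"
      using B by simp
    fix x y
    have "\<bar>g x - g y\<bar> \<le> 2 * M0"
      using M0(2)[of x] M0(2)[of y] by linarith
    also have "\<dots> \<le> max B (2 * M0)"
      by simp
    finally have 1: "\<bar>g x - g y\<bar> \<le> max B (2 * M0) * 1"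
      by simp
    have "\<bar>g x - g y\<bar> \<le> max B (2 * M0) * norm (x - y)"
      using lip[of x y] by (meson max.cobounded1 mult_right_mono norm_ge_zero order_trans)
    with 1 show "\<bar>g x - g y\<bar> \<le> max B (2 * M0) * min 1 (norm (x - y))"
      by (simp only: min_def split: if_split) simp
  qed
qed

section \<open>The extremal functions\<close>

text \<open>Half-width 2 puts the closed unit ball inside the open box, so the bump has a positive
  minimum there.\<close>

definition profile :: "'n::finite \<Rightarrow> real ^ 'n \<Rightarrow> real" where
  "profile e x = x $ e * box_bump 1 (\<chi> i. - 2) (\<chi> i. 2) x"

text \<open>For a = 2^(s-1), the product \<open>a ^ k * 2 ^ k\<close> is R^s with R = 2^k. It is
  split because \<open>2 ^ k\<close> undoes the contraction of the linear factor of
  \<open>profile\<close>, which leaves the coefficient \<open>a ^ k * t k\<close> in the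
  oscillation.\<close>

definition superposition :: "'n::finite \<Rightarrow> real \<Rightarrow> nat \<Rightarrow> (nat \<Rightarrow> real) \<Rightarrow> real ^ 'n \<Rightarrow> real" where
  "superposition e a N t x = (\<Sum>k<N. (t k * a ^ k * 2 ^ k) * profile e ((1 / 2) ^ k *\<^sub>R x))"

lemma test_function_profile: "test_function (profile e)"
  unfolding test_function_iff profile_def
proof
  show "smooth (\<lambda>x. x $ e * box_bump 1 (\<chi> i. - 2) (\<chi> i. 2) x)"
    by (intro smooth_mult smooth_nth smooth_box_bump)
  have "{x. x $ e * box_bump 1 (\<chi> i. - 2) (\<chi> i. 2) x \<noteq> 0} \<subseteq> box (\<chi> i. - 2) (\<chi> i. 2)"
    by (auto simp: box_bump_eq_0_iff)
  then show "bounded {x. x $ e * box_bump 1 (\<chi> i. - 2) (\<chi> i. 2) x \<noteq> 0}"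
    by (rule bounded_subset[OF bounded_box])
qed

lemma smooth_profile: "smooth (profile e)"
  using test_function_profile[of e] by (simp add: test_function_iff)

lemma smooth_superposition: "smooth (superposition e a N t)"
  unfolding superposition_def by (rule smooth_sum_scaled[OF smooth_profile])

lemma iter_partial_superposition:
  "iter_partial ds (superposition e a N t) x =
    (\<Sum>k<N. t k * a ^ k * 2 ^ k * ((1 / 2) ^ k) ^ length ds * iter_partial ds (profile e) ((1 / 2) ^ k *\<^sub>R x))"
  unfolding superposition_def by (subst iter_partial_sum_scaled(1)[OF smooth_profile]) (rule refl)

lemma test_function_superposition: "test_function (superposition e a N t)"
  unfolding test_function_iff
proof
  show "smooth (superposition e a N t)"
    by (rule smooth_superposition)
  obtain \<rho> where \<rho>: "\<rho> > 0" "{x. profile e x \<noteq> 0} \<subseteq> cball 0 \<rho>"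
    using bounded_support_cball test_function_profile[of e] by (metis test_function_iff)
  have "superposition e a N t x = 0" if x: "norm x > 2 ^ N * \<rho>" for x
    unfolding superposition_def
  proof (intro sum.neutral ballI)
    fix k
    assume "k \<in> {..<N}"
    then have "2 ^ k * \<rho> \<le> 2 ^ N * \<rho>"
      using \<rho>(1) by simp
    then have "norm ((1 / 2) ^ k *\<^sub>R x) > \<rho>"
      using x by (simp add: power_divide field_simps)
    then have "profile e ((1 / 2) ^ k *\<^sub>R x) = 0"
      using \<rho>(2) by force
    then show "t k * a ^ k * 2 ^ k * profile e ((1 / 2) ^ k *\<^sub>R x) = 0"
      by simp
  qed
  then have "{x. superposition e a N t x \<noteq> 0} \<subseteq> cball 0 (2 ^ N * \<rho>)"
    by (force simp: not_less)
  then show "bounded {x. superposition e a N t x \<noteq> 0}"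
    by (rule bounded_subset[OF bounded_cball])
qed

lemma profile_gradient_estimate:
  fixes e :: "'n::finite"
  obtains C \<rho> where "0 \<le> C" "0 \<le> \<rho>"
    "\<And>x y. (\<Sum>ds\<in>order_idx m. \<bar>iter_partial (rev ds) (profile e) x - iter_partial (rev ds) (profile e) y\<bar>) \<le>
      C * min 1 (norm (x - y)) * (indicator (cball 0 \<rho>) x + indicator (cball 0 \<rho>) y)"
proof -
  let ?g = "\<lambda>ds. iter_partial (rev ds) (profile e)"
  obtain \<rho> where \<rho>: "\<rho> > 0" "{x. profile e x \<noteq> 0} \<subseteq> cball 0 \<rho>"
    using bounded_support_cball test_function_profile[of e] by (metis test_function_iff)
  have supp: "{x. ?g ds x \<noteq> 0} \<subseteq> cball 0 \<rho>" for ds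
    by (rule iter_partial_support[OF closed_cball \<rho>(2)])
  have "\<exists>C\<ge>0. \<forall>x y. \<bar>?g ds x - ?g ds y\<bar> \<le> C * min 1 (norm (x - y))" for ds
    using test_function_difference_bound[OF test_function_iter_partial[OF test_function_profile]] by metis
  then obtain C where C: "\<And>ds. 0 \<le> C ds" "\<And>ds x y. \<bar>?g ds x - ?g ds y\<bar> \<le> C ds * min 1 (norm (x - y))"
    by metis
  show ?thesis
  proof
    show "0 \<le> (\<Sum>ds\<in>order_idx m. C ds)"
      by (intro sum_nonneg C)
    show "0 \<le> \<rho>"
      using \<rho> by simp
    fix x y :: "real ^ 'n"
    let ?i = "indicator (cball 0 \<rho>) x + indicator (cball 0 \<rho>) y :: real"
    have "\<bar>?g ds x - ?g ds y\<bar> \<le> C ds * min 1 (norm (x - y)) * ?i" for ds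
    proof (cases "x \<in> cball 0 \<rho> \<or> y \<in> cball 0 \<rho>")
      case True
      then have "1 \<le> ?i"
        by (auto simp: indicator_def)
      then have "C ds * min 1 (norm (x - y)) * 1 \<le> C ds * min 1 (norm (x - y)) * ?i"
        using C(1) by (intro mult_left_mono) auto
      then show ?thesis
        using C(2)[of ds x y] by linarith
    next
      case False
      then have "?g ds x = 0" "?g ds y = 0"
        using supp by blast+
      with False show ?thesis
        by simp
    qed
    then show "(\<Sum>ds\<in>order_idx m. \<bar>?g ds x - ?g ds y\<bar>) \<le> (\<Sum>ds\<in>order_idx m. C ds) * min 1 (norm (x - y)) * ?i"
      unfolding sum_distrib_right by (rule sum_mono)
  qed
qed

text \<open>The condition on \<open>a\<close> says that \<open>m\<close> derivatives of the bump at
  scale R = 2^k leave the factor R^\<sigma>; divided by |x - y|^\<sigma> it turns min(1, |x - y|/R)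
  into \<open>scale_kernel\<close> at |x - y|/R.\<close>

lemma superposition_gradient_estimate:
  fixes e :: "'n::finite"
  assumes a: "a * 2 * (1 / 2) ^ m = 2 powr \<sigma>" and t: "\<And>k. 0 \<le> t k"
    and C: "\<And>x y. (\<Sum>ds\<in>order_idx m. \<bar>iter_partial (rev ds) (profile e) x - iter_partial (rev ds) (profile e) y\<bar>) \<le>
      C * min 1 (norm (x - y)) * (indicator (cball 0 \<rho>) x + indicator (cball 0 \<rho>) y)"
    and xy: "x \<noteq> y"
  shows "L2_set (\<lambda>ds. iter_partial (rev ds) (superposition e a N t) x - iter_partial (rev ds) (superposition e a N t) y)
      (order_idx m) / norm (x - y) powr \<sigma> \<le>
    (\<Sum>k<N. t k * (C * scale_kernel \<sigma> (norm (x - y) / 2 ^ k) *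
      (indicator (cball 0 (2 ^ k * \<rho>)) x + indicator (cball 0 (2 ^ k * \<rho>)) y)))"
proof -
  let ?I = "order_idx m :: 'n list set"
  let ?g = "\<lambda>ds. iter_partial (rev ds) (profile e)"
  let ?d = "norm (x - y)"
  have d: "0 < ?d"
    using xy by simp
  have "L2_set (\<lambda>ds. iter_partial (rev ds) (superposition e a N t) x - iter_partial (rev ds) (superposition e a N t) y) ?I \<le>
      (\<Sum>ds\<in>?I. \<bar>iter_partial (rev ds) (superposition e a N t) x - iter_partial (rev ds) (superposition e a N t) y\<bar>)"
    by (rule L2_set_le_sum_abs)
  also have "\<dots> \<le> (\<Sum>ds\<in>?I. \<Sum>k<N. t k * (2 powr \<sigma>) ^ k *
      \<bar>?g ds ((1 / 2) ^ k *\<^sub>R x) - ?g ds ((1 / 2) ^ k *\<^sub>R y)\<bar>)"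
  proof (rule sum_mono)
    fix ds :: "'n list"
    assume "ds \<in> ?I"
    then have l: "length ds = m"
      by (simp add: order_idx_def)
    have coeff: "t k * a ^ k * 2 ^ k * ((1 / 2) ^ k) ^ m = t k * (2 powr \<sigma>) ^ k" for k
      unfolding a[symmetric] by (simp add: power_mult_distrib power_mult[symmetric] mult.commute[of k])
    have "\<bar>iter_partial (rev ds) (superposition e a N t) x - iter_partial (rev ds) (superposition e a N t) y\<bar> =
        \<bar>\<Sum>k<N. t k * (2 powr \<sigma>) ^ k * (?g ds ((1 / 2) ^ k *\<^sub>R x) - ?g ds ((1 / 2) ^ k *\<^sub>R y))\<bar>"
      unfolding iter_partial_superposition length_rev l coeff
      by (simp add: sum_subtractf right_diff_distrib)
    also have "\<dots> \<le> (\<Sum>k<N. \<bar>t k * (2 powr \<sigma>) ^ k * (?g ds ((1 / 2) ^ k *\<^sub>R x) - ?g ds ((1 / 2) ^ k *\<^sub>R y))\<bar>)"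
      by (rule sum_abs)
    finally show "\<bar>iter_partial (rev ds) (superposition e a N t) x - iter_partial (rev ds) (superposition e a N t) y\<bar> \<le>
        (\<Sum>k<N. t k * (2 powr \<sigma>) ^ k * \<bar>?g ds ((1 / 2) ^ k *\<^sub>R x) - ?g ds ((1 / 2) ^ k *\<^sub>R y)\<bar>)"
      using t by (simp add: abs_mult)
  qed
  also have "\<dots> = (\<Sum>k<N. t k * (2 powr \<sigma>) ^ k *
      (\<Sum>ds\<in>?I. \<bar>?g ds ((1 / 2) ^ k *\<^sub>R x) - ?g ds ((1 / 2) ^ k *\<^sub>R y)\<bar>))"
    by (subst sum.swap) (simp add: sum_distrib_left)
  also have "\<dots> \<le> (\<Sum>k<N. t k * (2 powr \<sigma>) ^ k * (C * min 1 (?d / 2 ^ k) *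
      (indicator (cball 0 (2 ^ k * \<rho>)) x + indicator (cball 0 (2 ^ k * \<rho>)) y)))"
  proof (intro sum_mono mult_left_mono)
    fix k
    have "norm ((1 / 2) ^ k *\<^sub>R x - (1 / 2) ^ k *\<^sub>R y) = ?d / 2 ^ k"
      by (simp add: scaleR_diff_right[symmetric] power_divide)
    moreover have "indicator (cball 0 \<rho>) ((1 / 2) ^ k *\<^sub>R z) = (indicator (cball 0 (2 ^ k * \<rho>)) z :: real)"
      for z :: "real ^ 'n"
      by (simp add: indicator_def power_divide field_simps)
    ultimately show "(\<Sum>ds\<in>?I. \<bar>?g ds ((1 / 2) ^ k *\<^sub>R x) - ?g ds ((1 / 2) ^ k *\<^sub>R y)\<bar>) \<le>
        C * min 1 (?d / 2 ^ k) * (indicator (cball 0 (2 ^ k * \<rho>)) x + indicator (cball 0 (2 ^ k * \<rho>)) y)"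
      using C[of "(1 / 2) ^ k *\<^sub>R x" "(1 / 2) ^ k *\<^sub>R y"] by simp
  qed (use t in auto)
  finally have "L2_set (\<lambda>ds. iter_partial (rev ds) (superposition e a N t) x - iter_partial (rev ds) (superposition e a N t) y) ?I / ?d powr \<sigma> \<le>
      (\<Sum>k<N. t k * (2 powr \<sigma>) ^ k * (C * min 1 (?d / 2 ^ k) *
      (indicator (cball 0 (2 ^ k * \<rho>)) x + indicator (cball 0 (2 ^ k * \<rho>)) y))) / ?d powr \<sigma>"
    by (rule divide_right_mono) simp
  also have "\<dots> = (\<Sum>k<N. t k * (C * scale_kernel \<sigma> (?d / 2 ^ k) *
      (indicator (cball 0 (2 ^ k * \<rho>)) x + indicator (cball 0 (2 ^ k * \<rho>)) y)))"
    unfolding sum_divide_distrib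
  proof (rule sum.cong[OF refl])
    fix k
    have "(2 powr \<sigma>) ^ k = (2 ^ k) powr \<sigma>"
      by (simp add: powr_realpow[symmetric] powr_powr mult.commute)
    then have "scale_kernel \<sigma> (?d / 2 ^ k) = min 1 (?d / 2 ^ k) * (2 powr \<sigma>) ^ k / ?d powr \<sigma>"
      using d by (simp add: scale_kernel_def powr_divide)
    then show "t k * (2 powr \<sigma>) ^ k * (C * min 1 (?d / 2 ^ k) *
        (indicator (cball 0 (2 ^ k * \<rho>)) x + indicator (cball 0 (2 ^ k * \<rho>)) y)) / ?d powr \<sigma> =
        t k * (C * scale_kernel \<sigma> (?d / 2 ^ k) *
        (indicator (cball 0 (2 ^ k * \<rho>)) x + indicator (cball 0 (2 ^ k * \<rho>)) y))"
      by (simp only:) (simp add: mult_ac)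
  qed
  finally show ?thesis .
qed

lemma frac_modular_cong_AE:
  assumes "AE x in lebesgue. \<forall>i\<in>I. v x i = w x i"
  shows "frac_modular \<sigma> A I v = frac_modular \<sigma> A I w"
  unfolding frac_modular_def
proof (rule nn_integral_cong_AE, use assms in eventually_elim)
  case (elim x)
  show ?case
  proof (rule nn_integral_cong_AE, use assms in eventually_elim)
    case (elim y)
    with \<open>\<forall>i\<in>I. v x i = w x i\<close> have "L2_set (\<lambda>i. v x i - v y i) I = L2_set (\<lambda>i. w x i - w y i) I"
      by (intro L2_set_cong) auto
    then show ?case
      by simp
  qed
qed

text \<open>Outside a ball containing the support, the chosen weak gradient vanishes only off a null
  set \<open>Z\<close>, so the level set is covered by the ball together with
  \<open>Z\<close>.\<close>

lemma emeasure_weak_grad_level_set_finite: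
  fixes u :: "real ^ 'n::finite \<Rightarrow> real"
  assumes "test_function u" "0 < \<tau>"
  shows "emeasure lebesgue {x. L2_set (weak_grad u x) (order_idx h) > \<tau>} < \<infinity>"
proof -
  obtain R where R: "R > 0" "{x. u x \<noteq> 0} \<subseteq> cball 0 R"
    using bounded_support_cball assms(1) by (metis test_function_iff)
  have "smooth u"
    using assms(1) by (simp add: test_function_iff)
  from weak_grad_smooth[OF this, of h] obtain Z where Z: "Z \<in> null_sets lebesgue"
    "{x. \<not> (\<forall>ds\<in>order_idx h. weak_grad u x ds = iter_partial (rev ds) u x)} \<subseteq> Z"
    by (auto simp: eventually_ae_filter)
  have "{x. L2_set (weak_grad u x) (order_idx h) > \<tau>} \<subseteq> cball 0 R \<union> Z"
  proof
    fix x
    assume x: "x \<in> {x. L2_set (weak_grad u x) (order_idx h) > \<tau>}"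
    show "x \<in> cball 0 R \<union> Z"
    proof (rule ccontr)
      assume "x \<notin> cball 0 R \<union> Z"
      then have "iter_partial (rev ds) u x = 0" "ds \<in> order_idx h \<Longrightarrow> weak_grad u x ds = iter_partial (rev ds) u x" for ds
        using Z(2) iter_partial_support[OF closed_cball R(2), of "rev ds"] by blast+
      then have "weak_grad u x ds = 0" if "ds \<in> order_idx h" for ds
        using that by simp
      then have "L2_set (weak_grad u x) (order_idx h) = 0"
        by (intro L2_set_0') auto
      then show False
        using x assms(2) by simp
    qed
  qed
  then have "emeasure lebesgue {x. L2_set (weak_grad u x) (order_idx h) > \<tau>} \<le> emeasure lebesgue (cball 0 R \<union> Z)"
    using Z(1) by (intro emeasure_mono) auto
  also have "\<dots> = emeasure lebesgue (cball (0 :: real ^ 'n) R)"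
    by (rule emeasure_Un_null_set[OF _ Z(1)]) simp
  also have "\<dots> < \<infinity>"
    using emeasure_lborel_cball_finite[of "0 :: real ^ 'n" R] by simp
  finally show ?thesis .
qed

lemma superposition_in_V_space:
  fixes e :: "'n::finite"
  assumes A: "young_function A" and \<sigma>: "0 < frac s" and m: "s \<ge> 0"
  obtains D where "0 < D"
    "\<And>N t. (\<And>k. 0 \<le> t k) \<Longrightarrow> (\<Sum>k<N. ennreal ((2 ^ CARD('n)) ^ k) * A (t k)) \<le> 1 \<Longrightarrow>
      superposition e (2 powr (s - 1)) N t \<in> V_space_d1 s A \<and>
      V_seminorm s A (superposition e (2 powr (s - 1)) N t) \<le> ennreal D"
proof -
  let ?m = "nat \<lfloor>s\<rfloor>" and ?\<sigma> = "frac s" and ?a = "2 powr (s - 1)"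
  have \<sigma>1: "?\<sigma> < 1"
    by (rule frac_lt_1)
  have s: "s = real ?m + ?\<sigma>"
    using m by (simp add: frac_def)
  have "2 powr (s - 1) * 2 = 2 powr s"
    by (simp add: powr_diff)
  also have "\<dots> = 2 powr (real ?m + ?\<sigma>)"
    using s by simp
  also have "\<dots> = 2 ^ ?m * 2 powr ?\<sigma>"
    by (simp add: powr_add powr_realpow)
  finally have a: "?a * 2 * (1 / 2) ^ ?m = 2 powr ?\<sigma>"
    by (simp add: power_divide)
  obtain C1 where C1: "\<And>d N. 0 < d \<Longrightarrow> (\<Sum>k<N. scale_kernel ?\<sigma> (d / 2 ^ k)) \<le> C1"
    using sum_scale_kernel_bounded[OF \<sigma> \<sigma>1] by blast
  obtain C2 where C2: "0 \<le> C2" "\<And>R. 0 < R \<Longrightarrow> (\<integral>\<^sup>+h. ennreal (scale_kernel ?\<sigma> (norm (h :: real ^ 'n) / R) / norm h ^ CARD('n)) \<partial>lborel) \<le> ennreal C2"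
    using nn_integral_scale_kernel_bounded[OF \<sigma> \<sigma>1] by blast
  obtain C \<rho> where C: "0 \<le> C" "0 \<le> \<rho>"
    "\<And>x y. (\<Sum>ds\<in>order_idx ?m. \<bar>iter_partial (rev ds) (profile e) x - iter_partial (rev ds) (profile e) y\<bar>) \<le>
      C * min 1 (norm (x - y)) * (indicator (cball 0 \<rho>) x + indicator (cball 0 \<rho>) y)"
    using profile_gradient_estimate by blast
  define D where "D = max 1 (max (2 * C * C1) (2 * C * C2 * (unit_ball_vol (real CARD('n)) * \<rho> ^ CARD('n))))"
  have D: "0 < D" "2 * C * C1 \<le> D" "2 * C * C2 * (unit_ball_vol (real CARD('n)) * \<rho> ^ CARD('n)) \<le> D"
    by (auto simp: D_def)
  show ?thesis
  proof
    show "0 < D"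
      by (rule D)
    fix N t
    assume t: "\<And>k. 0 \<le> t k" and le: "(\<Sum>k<N. ennreal ((2 ^ CARD('n)) ^ k) * A (t k)) \<le> 1"
    let ?u = "superposition e ?a N t"
    have u: "test_function ?u" "smooth ?u"
      by (rule test_function_superposition smooth_superposition)+
    have "frac_modular ?\<sigma> A (order_idx ?m) (\<lambda>x i. weak_grad ?u x i / D) =
        frac_modular ?\<sigma> A (order_idx ?m) (\<lambda>x ds. iter_partial (rev ds) ?u x / D)"
      by (rule frac_modular_cong_AE, use weak_grad_smooth[OF u(2), of ?m] in eventually_elim) auto
    also have "\<dots> \<le> (\<Sum>k<N. ennreal ((2 ^ CARD('n)) ^ k) * A (t k))"
      using superposition_gradient_estimate[OF a t C(3)]
      by (intro frac_modular_le[OF A t C(1,2) D(1) _ C1 C2(2,1) D(2,3)]) auto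
    also note le
    finally have "V_seminorm s A ?u \<le> ennreal D"
      unfolding V_seminorm_def frac_seminorm_def using D(1) by (intro Inf_lower) auto
    moreover from this have "V_seminorm s A ?u < \<infinity>"
      by (metis ennreal_less_top infinity_ennreal_def le_less_trans)
    ultimately show "?u \<in> V_space_d1 s A \<and> V_seminorm s A ?u \<le> ennreal D"
      using u by (auto simp: V_space_d1_def V_space_def weakly_differentiable_smooth
          smooth_borel_measurable(3) emeasure_weak_grad_level_set_finite[unfolded infinity_ennreal_def])
  qed
qed

section \<open>Oscillation of the extremal functions\<close>

lemma set_integrable_ball:
  fixes f :: "'a::euclidean_space \<Rightarrow> real"
  assumes "continuous_on UNIV f"
  shows "set_integrable lborel (ball a r) f"
proof -
  have "set_integrable lborel (cball a r) f"
    unfolding set_integrable_def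
    by (intro borel_integrable_compact continuous_on_subset[OF assms]) auto
  then show ?thesis
    by (rule set_integrable_subset) auto
qed

lemma set_lebesgue_integral_lebesgue_eq:
  fixes f :: "'a::euclidean_space \<Rightarrow> real"
  assumes "f \<in> borel_measurable borel" "B \<in> sets borel"
  shows "(LINT x:B|lebesgue. f x) = (LINT x:B|lborel. f x)"
  unfolding set_lebesgue_integral_def using assms by (intro integral_completion) auto

lemma integral_ball_odd_eq_0:
  fixes f :: "'a::euclidean_space \<Rightarrow> real"
  assumes [measurable]: "f \<in> borel_measurable borel" and odd: "\<And>x. f (- x) = - f x"
  shows "(LINT x:ball 0 r|lborel. f x) = 0"
proof -
  let ?h = "\<lambda>x. indicator (ball 0 r) x *\<^sub>R f x"
  have [measurable]: "ball (0 :: 'a) r \<in> sets borel"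
    by simp
  have "(lborel :: 'a measure) = distr lborel borel uminus"
    using lborel_affine[of "- 1" "0 :: 'a"] by (simp add: density_1)
  then have "integral\<^sup>L lborel ?h = integral\<^sup>L (distr lborel borel uminus) ?h"
    by (rule arg_cong)
  also have "\<dots> = (LINT x|lborel. ?h (- x))"
    by (rule integral_distr) measurable
  also have "\<dots> = - integral\<^sup>L lborel ?h"
    by (simp add: odd indicator_def)
  finally show ?thesis
    by (simp add: set_lebesgue_integral_def)
qed

text \<open>Testing \<open>u - u\<^sub>B\<close> against \<open>x $ e\<close>, which has mean zero and is bounded by 1 on the unit ball.\<close>

lemma campanato_seminorm_ge:
  fixes u :: "real ^ 'n::finite \<Rightarrow> real"
  assumes u: "continuous_on UNIV u" and \<phi>: "admissible \<phi>"
  defines "B \<equiv> ball (0 :: real ^ 'n) 1"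
  shows "ennreal (1 / \<phi> (measure lebesgue B powr (1 / real CARD('n))) *
      ((LINT x:B|lborel. u x * x $ e) / measure lebesgue B)) \<le> campanato_seminorm \<phi> u"
proof -
  let ?c = "mean_value B u"
  have B: "B \<in> sets borel"
    by (simp add: B_def)
  have int: "set_integrable lborel B f" if "continuous_on UNIV f" for f :: "real ^ 'n \<Rightarrow> real"
    unfolding B_def using that by (rule set_integrable_ball)
  have meas_pos: "0 < measure lebesgue B"
    unfolding B_def using content_ball_pos[of 1 "0 :: real ^ 'n"] by simp
  have "(LINT x:B|lborel. u x * x $ e) = (LINT x:B|lborel. (u x - ?c) * x $ e + ?c * x $ e)"
    by (simp add: algebra_simps)
  also have "\<dots> = (LINT x:B|lborel. (u x - ?c) * x $ e) + (LINT x:B|lborel. ?c * x $ e)"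
    by (intro set_integral_add int continuous_intros u)
  also have "(LINT x:B|lborel. ?c * x $ e) = 0"
    unfolding B_def by (rule integral_ball_odd_eq_0) auto
  also have "(LINT x:B|lborel. (u x - ?c) * x $ e) + 0 \<le> (LINT x:B|lborel. \<bar>u x - ?c\<bar>)"
  proof -
    have "(LINT x:B|lborel. (u x - ?c) * x $ e) \<le> (LINT x:B|lborel. \<bar>u x - ?c\<bar>)"
    proof (rule set_integral_mono)
      fix x
      assume "x \<in> B"
      then have "\<bar>x $ e\<bar> \<le> 1"
        using component_le_norm_cart[of x e] by (simp add: B_def)
      then have "\<bar>u x - ?c\<bar> * \<bar>x $ e\<bar> \<le> \<bar>u x - ?c\<bar> * 1"
        by (intro mult_left_mono) auto
      then show "(u x - ?c) * x $ e \<le> \<bar>u x - ?c\<bar>"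
        using abs_ge_self[of "(u x - ?c) * x $ e"] by (simp add: abs_mult)
    qed (intro int continuous_intros u)+
    then show ?thesis
      by simp
  qed
  also have "\<dots> = (LINT x:B|lebesgue. \<bar>u x - ?c\<bar>)"
    using B by (intro set_lebesgue_integral_lebesgue_eq[symmetric] borel_measurable_continuous_onI
        continuous_intros u)
  finally have "(LINT x:B|lborel. u x * x $ e) / measure lebesgue B \<le> mean_value B (\<lambda>x. \<bar>u x - ?c\<bar>)"
    unfolding mean_value_def[of B "\<lambda>x. \<bar>u x - ?c\<bar>"] by (intro divide_right_mono) auto
  moreover have "0 < \<phi> (measure lebesgue B powr (1 / real CARD('n)))"
    using \<phi> meas_pos by (simp add: admissible_def)
  ultimately have "ennreal (1 / \<phi> (measure lebesgue B powr (1 / real CARD('n))) *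
      ((LINT x:B|lborel. u x * x $ e) / measure lebesgue B)) \<le>
      ennreal (1 / \<phi> (measure lebesgue B powr (1 / real CARD('n))) * mean_value B (\<lambda>x. \<bar>u x - ?c\<bar>))"
    by (intro ennreal_leI mult_left_mono) auto
  also have "\<dots> \<le> campanato_seminorm \<phi> u"
    unfolding campanato_seminorm_def
    using B_def zero_less_one by (intro Sup_upper) blast
  finally show ?thesis .
qed

text \<open>Dividing by 2^k keeps points in the unit ball, where the bump is at least
  \<open>b0\<close>. Hence each rescaled profile times \<open>x $ e\<close> is at least b0 (x_e)^2
  there, with the same bound at all scales and no cancellation between them.\<close>

lemma superposition_moment_ge:
  fixes e :: "'n::finite"
  obtains q where "0 < q"
    "\<And>a N t. 0 \<le> a \<Longrightarrow> (\<And>k. 0 \<le> t k) \<Longrightarrow>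
      q * (\<Sum>k<N. a ^ k * t k) \<le> (LINT x:ball 0 1|lborel. superposition e a N t x * x $ e)"
proof -
  let ?b = "box_bump 1 (\<chi> i. - 2) (\<chi> i. 2) :: real ^ 'n \<Rightarrow> real"
  let ?B = "ball (0 :: real ^ 'n) 1"
  let ?z = "axis e (1 / 2) :: real ^ 'n"
  have b_pos: "0 < ?b x" if "norm x \<le> 1" for x
  proof -
    have "\<bar>x $ i\<bar> \<le> 1" for i
      using component_le_norm_cart[of x i] that by linarith
    then have "x \<in> box (\<chi> i. - 2) (\<chi> i. 2)"
      unfolding mem_box_cart by (auto simp: abs_le_iff) (smt (verit))+
    then have "?b x \<noteq> 0"
      by (simp add: box_bump_eq_0_iff)
    then show ?thesis
      using box_bump_nonneg[of 1 "\<chi> i. - 2" "\<chi> i. 2" x] by linarith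
  qed
  have "\<exists>x\<in>cball 0 1. \<forall>y\<in>cball 0 1. ?b x \<le> ?b y"
    by (intro continuous_attains_inf smooth_continuous smooth_box_bump) auto
  then obtain x0 where x0: "norm x0 \<le> 1" "\<And>y. norm y \<le> 1 \<Longrightarrow> ?b x0 \<le> ?b y"
    by auto
  define b0 where "b0 = ?b x0"
  have b0: "0 < b0" "\<And>y. norm y \<le> 1 \<Longrightarrow> b0 \<le> ?b y"
    using b_pos[OF x0(1)] x0(2) by (auto simp: b0_def)
  define q where "q = b0 * (LINT x:?B|lborel. (x $ e)\<^sup>2)"
  have int: "set_integrable lborel ?B f" if "continuous_on UNIV f" for f :: "real ^ 'n \<Rightarrow> real"
    using that by (rule set_integrable_ball)
  \<comment> \<open>The second moment is positive because x_e \<ge> 1/4 on the ball of radius 1/4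
    about half the unit vector, which lies in the unit ball.\<close>
  have "0 < (1 / 16) * measure lborel (ball ?z (1 / 4))"
    using content_ball_pos[of "1 / 4" ?z] by simp
  also have "\<dots> = (LINT x:ball ?z (1 / 4)|lborel. 1 / 16)"
    by (simp add: set_lebesgue_integral_def)
  also have "\<dots> \<le> (LINT x:?B|lborel. (x $ e)\<^sup>2)"
    unfolding set_lebesgue_integral_def
  proof (rule integral_mono)
    show "integrable lborel (\<lambda>x. indicat_real (ball ?z (1 / 4)) x *\<^sub>R (1 / 16 :: real))"
      using set_integrable_ball[of "\<lambda>x. 1 / 16 :: real" ?z "1 / 4"] by (simp add: set_integrable_def)
    show "integrable lborel (\<lambda>x. indicat_real ?B x *\<^sub>R (x $ e)\<^sup>2)"
      unfolding set_integrable_def[symmetric] by (intro int continuous_intros)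
    fix x :: "real ^ 'n"
    show "indicat_real (ball ?z (1 / 4)) x *\<^sub>R (1 / 16) \<le> indicat_real ?B x *\<^sub>R (x $ e)\<^sup>2"
    proof (cases "x \<in> ball ?z (1 / 4)")
      case True
      then have d: "norm (x - ?z) < 1 / 4"
        by (simp add: dist_norm norm_minus_commute)
      then have "\<bar>(x - ?z) $ e\<bar> < 1 / 4"
        using component_le_norm_cart[of "x - ?z" e] by linarith
      then have "1 / 4 \<le> x $ e"
        unfolding abs_less_iff by simp
      then have "(1 / 4)\<^sup>2 \<le> (x $ e)\<^sup>2"
        by (intro power_mono) auto
      moreover have "?z = (1 / 2) *\<^sub>R axis e 1"
        by (simp add: vec_eq_iff axis_def)
      then have "norm ?z = 1 / 2"
        by simp
      then have "norm x < 1"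
        using d norm_triangle_sub[of x ?z] by linarith
      ultimately show ?thesis
        using True by (simp add: power2_eq_square)
    qed simp
  qed
  finally have q: "0 < q"
    using b0 by (simp add: q_def)
  have moment: "q \<le> (LINT x:?B|lborel. 2 ^ k * profile e ((1 / 2) ^ k *\<^sub>R x) * x $ e)" for k
  proof -
    have "continuous_on UNIV (\<lambda>x. profile e ((1 / 2) ^ k *\<^sub>R x))"
      by (rule continuous_on_compose2[OF smooth_continuous[OF smooth_profile, of UNIV]]) (auto intro!: continuous_intros)
    note cont = this
    have "q = (LINT x:?B|lborel. b0 * (x $ e)\<^sup>2)"
      unfolding q_def by (rule set_integral_mult_right[symmetric])
    also have "\<dots> \<le> (LINT x:?B|lborel. 2 ^ k * profile e ((1 / 2) ^ k *\<^sub>R x) * x $ e)"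
    proof (rule set_integral_mono)
      fix x :: "real ^ 'n"
      assume "x \<in> ?B"
      then have "norm ((1 / 2) ^ k *\<^sub>R x) \<le> 1"
        by (simp add: power_divide mult_le_one divide_le_eq)
           (smt (verit) one_le_power)
      then have "b0 * (x $ e)\<^sup>2 \<le> ?b ((1 / 2) ^ k *\<^sub>R x) * (x $ e)\<^sup>2"
        by (intro mult_right_mono b0) auto
      also have "\<dots> = 2 ^ k * profile e ((1 / 2) ^ k *\<^sub>R x) * x $ e"
        by (simp add: profile_def power_divide power2_eq_square)
      finally show "b0 * (x $ e)\<^sup>2 \<le> 2 ^ k * profile e ((1 / 2) ^ k *\<^sub>R x) * x $ e" .
    qed (intro int continuous_intros cont)+
    finally show ?thesis .
  qed
  show ?thesis
  proof
    show "0 < q"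
      by (rule q)
    fix a :: real and N and t :: "nat \<Rightarrow> real"
    assume a: "0 \<le> a" and t: "\<And>k. 0 \<le> t k"
    have "q * (\<Sum>k<N. a ^ k * t k) = (\<Sum>k<N. t k * a ^ k * q)"
      by (simp add: sum_distrib_left mult_ac)
    also have "\<dots> \<le> (\<Sum>k<N. t k * a ^ k * (LINT x:?B|lborel. 2 ^ k * profile e ((1 / 2) ^ k *\<^sub>R x) * x $ e))"
      using a t by (intro sum_mono mult_left_mono moment) auto
    also have "\<dots> = (\<Sum>k<N. LINT x:?B|lborel. t k * a ^ k * (2 ^ k * profile e ((1 / 2) ^ k *\<^sub>R x) * x $ e))"
      by simp
    also have "\<dots> = (LINT x:?B|lborel. (\<Sum>k<N. t k * a ^ k * (2 ^ k * profile e ((1 / 2) ^ k *\<^sub>R x) * x $ e)))"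
    proof -
      have "continuous_on UNIV (\<lambda>x. profile e ((1 / 2) ^ k *\<^sub>R x))" for k
        by (rule continuous_on_compose2[OF smooth_continuous[OF smooth_profile, of UNIV]]) (auto intro!: continuous_intros)
      then have "set_integrable lborel ?B (\<lambda>x. t k * a ^ k * (2 ^ k * profile e ((1 / 2) ^ k *\<^sub>R x) * x $ e))" for k
        by (intro int continuous_intros)
      then show ?thesis
        unfolding set_lebesgue_integral_def set_integrable_def
        by (subst Bochner_Integration.integral_sum[symmetric]) (auto simp: sum_distrib_left scaleR_sum_right)
    qed
    also have "\<dots> = (LINT x:?B|lborel. superposition e a N t x * x $ e)"
      by (simp add: superposition_def sum_distrib_right mult.assoc)
    finally show "q * (\<Sum>k<N. a ^ k * t k) \<le> (LINT x:?B|lborel. superposition e a N t x * x $ e)" .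
  qed
qed

section \<open>From the embedding to the integral condition\<close>

lemma embedding_bounds_sequences:
  assumes s: "0 < frac s" "0 \<le> s" and A: "young_function A" and \<phi>: "admissible \<phi>"
    and emb: "continuously_embedded (V_seminorm s A) (V_space_d1 s A :: (real ^ 'n::finite \<Rightarrow> real) set)
      (campanato_seminorm \<phi>) (campanato_space \<phi>)"
  obtains M where
    "\<And>N t. (\<And>k. 0 \<le> t k) \<Longrightarrow> (\<Sum>k<N. ennreal ((2 ^ CARD('n)) ^ k) * A (t k)) \<le> 1 \<Longrightarrow>
      (\<Sum>k<N. (2 powr (s - 1)) ^ k * t k) \<le> M"
proof -
  \<comment> \<open>Index types are inhabited, so a coordinate direction exists; the conclusion does
    not mention it.\<close>
  fix e :: 'n
  let ?B = "ball (0 :: real ^ 'n) 1"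
  obtain c where c: "\<And>u :: real ^ 'n \<Rightarrow> real. u \<in> V_space_d1 s A \<Longrightarrow> campanato_seminorm \<phi> u \<le> ennreal c * V_seminorm s A u"
    using emb unfolding continuously_embedded_def by blast
  obtain D where D: "0 < D"
    "\<And>N t. (\<And>k. 0 \<le> t k) \<Longrightarrow> (\<Sum>k<N. ennreal ((2 ^ CARD('n)) ^ k) * A (t k)) \<le> 1 \<Longrightarrow>
      superposition e (2 powr (s - 1)) N t \<in> V_space_d1 s A \<and>
      V_seminorm s A (superposition e (2 powr (s - 1)) N t) \<le> ennreal D"
    using superposition_in_V_space[OF A s] by blast
  obtain q where q: "0 < q"
    "\<And>a N t. 0 \<le> a \<Longrightarrow> (\<And>k. 0 \<le> t k) \<Longrightarrow>
      q * (\<Sum>k<N. a ^ k * t k) \<le> (LINT x:?B|lborel. superposition e a N t x * x $ e)"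
    using superposition_moment_ge by blast
  let ?\<mu> = "measure lebesgue ?B"
  let ?\<phi> = "\<phi> (?\<mu> powr (1 / real CARD('n)))"
  have \<mu>: "0 < ?\<mu>"
    using content_ball_pos[of 1 "0 :: real ^ 'n"] by simp
  then have \<phi>_pos: "0 < ?\<phi>"
    using \<phi> by (simp add: admissible_def)
  show ?thesis
  proof
    fix N and t :: "nat \<Rightarrow> real"
    assume t: "\<And>k. 0 \<le> t k" and le: "(\<Sum>k<N. ennreal ((2 ^ CARD('n)) ^ k) * A (t k)) \<le> 1"
    let ?a = "2 powr (s - 1)"
    let ?u = "superposition e ?a N t"
    let ?S = "\<Sum>k<N. ?a ^ k * t k"
    have u: "?u \<in> V_space_d1 s A" "V_seminorm s A ?u \<le> ennreal D"
      using D(2)[OF t le] by auto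
    have "ennreal (1 / ?\<phi> * (q * ?S / ?\<mu>)) \<le> ennreal (1 / ?\<phi> * ((LINT x:?B|lborel. ?u x * x $ e) / ?\<mu>))"
      using q(2)[of ?a t N] t \<phi>_pos by (intro ennreal_leI mult_left_mono divide_right_mono) auto
    also have "\<dots> \<le> campanato_seminorm \<phi> ?u"
      by (rule campanato_seminorm_ge[OF smooth_continuous[OF smooth_superposition] \<phi>])
    also have "\<dots> \<le> ennreal c * V_seminorm s A ?u"
      by (rule c[OF u(1)])
    \<comment> \<open>The embedding constant is an arbitrary real, and \<open>ennreal\<close> sends
      negative values to 0.\<close>
    also have "\<dots> \<le> ennreal (max 0 c) * ennreal D"
      using u(2) by (intro mult_mono ennreal_leI) auto
    also have "\<dots> = ennreal (max 0 c * D)"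
      using D(1) by (simp add: ennreal_mult)
    finally have "1 / ?\<phi> * (q * ?S / ?\<mu>) \<le> max 0 c * D"
      using D(1) by (subst (asm) ennreal_le_iff) auto
    then show "?S \<le> max 0 c * D * ?\<phi> * ?\<mu> / q"
      using \<phi>_pos \<mu> q(1) by (simp add: field_simps)
  qed
qed

theorem theorem4p1:
  fixes s :: real and A :: "real \<Rightarrow> ennreal"
  assumes "s > 1" and "s \<notin> \<nat>"
    and "young_function A"
    and "\<exists>\<phi>. admissible \<phi> \<and>
           continuously_embedded (V_seminorm s A) (V_space_d1 s A :: (real ^ 'n::finite \<Rightarrow> real) set)
             (campanato_seminorm \<phi>) (campanato_space \<phi>)"
  shows "s \<in> {1<..<real CARD('n) + 1} - \<nat> \<and>
    (\<exists>\<delta>>0. (\<integral>\<^sup>+t\<in>{0<..<\<delta>}.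
       ennreal_powr (ennreal t / A t) ((s - 1) / (real CARD('n) + 1 - s)) \<partial>lebesgue) < \<infinity>)"
proof -
  let ?n = "real CARD('n)" and ?a = "2 powr (s - 1)" and ?b = "2 ^ CARD('n) :: real"
  have "s \<notin> \<int>"
    using assms(1,2) by (auto simp: Nats_altdef2)
  then have frac: "0 < frac s"
    by simp
  have s0: "0 \<le> s"
    using assms(1) by simp
  obtain \<phi> where \<phi>: "admissible \<phi>"
    "continuously_embedded (V_seminorm s A) (V_space_d1 s A :: (real ^ 'n \<Rightarrow> real) set)
      (campanato_seminorm \<phi>) (campanato_space \<phi>)"
    using assms(4) by blast
  obtain M where M: "\<And>N t. (\<And>k. 0 \<le> t k) \<Longrightarrow> (\<Sum>k<N. ennreal (?b ^ k) * A (t k)) \<le> 1 \<Longrightarrow>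
      (\<Sum>k<N. ?a ^ k * t k) \<le> M"
    using embedding_bounds_sequences[OF frac s0 assms(3) \<phi>] by blast
  \<comment> \<open>Both sequence lemmas produce sums above any prescribed level, so the level
    \<open>M + 1\<close> contradicts the bound \<open>M\<close>.\<close>
  have no: False if ex: "\<exists>N t. (\<forall>k. 0 \<le> t k) \<and> (\<Sum>k<N. ennreal (?b ^ k) * A (t k)) \<le> 1 \<and>
      M + 1 \<le> (\<Sum>k<N. ?a ^ k * t k)"
  proof -
    obtain N t where "\<And>k. 0 \<le> t k" "(\<Sum>k<N. ennreal (?b ^ k) * A (t k)) \<le> 1"
      "M + 1 \<le> (\<Sum>k<N. ?a ^ k * t k)"
      using ex by blast
    with M[of t N] show False
      by force
  qed
  have b: "?b = 2 powr ?n"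
    by (simp add: powr_realpow)
  \<comment> \<open>The borderline a = b is an integer value of \<open>s\<close> and therefore
    excluded.\<close>
  have "s \<noteq> ?n + 1"
    using assms(2) by (metis Nats_1 Nats_add of_nat_in_Nats)
  moreover have "\<not> ?n + 1 < s"
  proof
    assume "?n + 1 < s"
    then have "?b < ?a"
      unfolding b by simp
    then show False
      by (intro no young_sequence_supercritical[OF assms(3)]) auto
  qed
  ultimately have sn: "s < ?n + 1"
    by linarith
  \<comment> \<open>This is the solution of (b/a)^p = a, since b/a = 2^(n+1-s) and a =
    2^(s-1).\<close>
  let ?p = "(s - 1) / (?n + 1 - s)"
  have "\<exists>\<delta>>0. (\<integral>\<^sup>+t\<in>{0<..<\<delta>}. ennreal_powr (ennreal t / A t) ?p \<partial>lebesgue) < \<infinity>"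
  proof (rule ccontr)
    assume neg: "\<not> ?thesis"
    show False
    proof (intro no young_sequence_divergent[OF assms(3)])
      show "1 < ?a" "?a < ?b"
        using assms(1) sn unfolding b by simp_all
      show "0 < ?p"
        using assms(1) sn by simp
      have "?b / ?a = 2 powr (?n + 1 - s)"
        unfolding b by (simp add: powr_diff[symmetric] algebra_simps)
      then show "(?b / ?a) powr ?p = ?a"
        using sn by (simp add: powr_powr)
      show "(\<integral>\<^sup>+t\<in>{0<..<\<delta>}. ennreal_powr (ennreal t / A t) ?p \<partial>lebesgue) = \<infinity>" if "\<delta> > 0" for \<delta>
        using neg that unfolding infinity_ennreal_def by (metis top.not_eq_extremum)
    qed
  qed
  then show ?thesis
    using assms(1,2) sn by simp
qed

end
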